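(* Let $\nu>-1/2$, $\mu\in\mathbb{R}$ and $\alpha>|\beta|$. Let $W$ be a real-valued random variable. Then $W$ follows the $\mathrm{VG}_2(\nu,\alpha,\beta,\mu)$ distribution if and only if $$\mathbb{E}\left[(W-\mu)f''(W)+(2\nu+1+2\beta(W-\mu))f'(W)+((2\nu+1)\beta-(\alpha^2-\beta^2)(W-\mu))f(W)\right]=0$$ for all piecewise twice continuously differentiable functions $f:\mathbb{R}\to\mathbb{R}$ that satisfy $$\lim_{x\to\infty}f^{(k)}(x)\,x^{\nu+3/2}e^{-(\alpha-\beta)x}=0\quad\text{and}\quad\lim_{x\to-\infty}f^{(k)}(x)\,(-x)^{\nu+3/2}e^{(\alpha+\beta)x}=0$$ for $k=0,1,2$, where $f^{(0)}\equiv f$.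
   Context: For $\nu>-1/2$, $\mu\in\mathbb{R}$, $\alpha>|\beta|$, the distribution $\mathrm{VG}_2(\nu,\alpha,\beta,\mu)$ is the law on $\mathbb{R}$ with density $$p(x)=\frac{(\alpha^2-\beta^2)^{\nu+1/2}}{\sqrt{\pi}\,\Gamma(\nu+\frac12)}\left(\frac{|x-\mu|}{2\alpha}\right)^{\nu}e^{\beta(x-\mu)}K_\nu(\alpha|x-\mu|),$$ where $K_\nu$ is the modified Bessel function of the second kind.
   Formalization: The identity is required only for those f whose expectation exists, as the growth conditions do not ensure integrability even under the VG law; "piecewise twice continuously differentiable" is read as f continuously differentiable with f' piecewise continuously differentiable. *)

theory Defs
  imports "HOL-Probability.Probability"
begin

text \<open>
  The modified Bessel function of the second kind, of real order \<open>\<nu>\<close> and argument \<open>x > 0\<close>,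
  given by \<open>K\<^sub>\<nu>(x) = \<integral>\<^sub>0\<^sup>\<infinity> exp (- x cosh t) cosh (\<nu> t) dt\<close>.
  The integral diverges for \<open>x \<le> 0\<close>, where the value is the default \<open>0\<close>;
  below, this concerns only the null set \<open>x = \<mu>\<close>.
\<close>

definition bessel_K :: "real \<Rightarrow> real \<Rightarrow> real" where
  "bessel_K \<nu> x = (LINT t:{0..}|lborel. exp (- x * cosh t) * cosh (\<nu> * t))"

definition VG2_density :: "real \<Rightarrow> real \<Rightarrow> real \<Rightarrow> real \<Rightarrow> real \<Rightarrow> real" where
  "VG2_density \<nu> \<alpha> \<beta> \<mu> x =
     (\<alpha>\<^sup>2 - \<beta>\<^sup>2) powr (\<nu> + 1/2) / (sqrt pi * Gamma (\<nu> + 1/2)) *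
     (\<bar>x - \<mu>\<bar> / (2 * \<alpha>)) powr \<nu> * exp (\<beta> * (x - \<mu>)) * bessel_K \<nu> (\<alpha> * \<bar>x - \<mu>\<bar>)"

text \<open>
  Piecewise twice continuously differentiable: \<open>f\<close> is differentiable everywhere, \<open>f'\<close> is
  continuous, and \<open>f'\<close> is continuously differentiable off a finite set. Jumps of \<open>f\<close> or \<open>f'\<close>
  are excluded, since they would contribute boundary terms to the Stein identity.
  At the exceptional points \<open>deriv (deriv f)\<close> is an unspecified real number; such points are
  null for an absolutely continuous law, and the test functions without exceptional points
  form a subclass to which this convention does not apply.
\<close>

definition piecewise_C2 :: "(real \<Rightarrow> real) \<Rightarrow> bool" where
  "piecewise_C2 f \<longleftrightarrow>
     (\<forall>x. f differentiable at x) \<and> deriv f piecewise_C1_differentiable_on UNIV"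

definition stein_VG2 ::
  "real \<Rightarrow> real \<Rightarrow> real \<Rightarrow> real \<Rightarrow> (real \<Rightarrow> real) \<Rightarrow> real \<Rightarrow> real" where
  "stein_VG2 \<nu> \<alpha> \<beta> \<mu> f x =
     (x - \<mu>) * deriv (deriv f) x
     + (2 * \<nu> + 1 + 2 * \<beta> * (x - \<mu>)) * deriv f x
     + ((2 * \<nu> + 1) * \<beta> - (\<alpha>\<^sup>2 - \<beta>\<^sup>2) * (x - \<mu>)) * f x"

text \<open>
  The growth conditions do not by themselves make \<open>stein_VG2 \<nu> \<alpha> \<beta> \<mu> f (W)\<close> integrable, not even
  when \<open>W\<close> has the density \<open>VG2_density \<nu> \<alpha> \<beta> \<mu>\<close>: take
  \<open>f x = exp ((\<alpha> - \<beta>) * x) * x powr (- \<nu> - 3/2) * sin x / ln x\<close> for large \<open>x\<close>. So the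
  requirement that the expectation vanish is imposed on those \<open>f\<close> for which it exists.
\<close>

end

theory Submission
  imports Defs
begin

text \<open>
  Put \<open>\<gamma> = \<alpha>\<^sup>2 - \<beta>\<^sup>2\<close>. The substitution \<open>v = (\<bar>y\<bar> / \<alpha>) exp t\<close> turns \<open>\<bar>y\<bar>\<^sup>\<nu> K\<^sub>\<nu>(\<alpha> \<bar>y\<bar>)\<close> into a multiple of
  \<open>G\<^sub>\<nu>(y) = \<integral> v powr (\<nu> - 1) exp (- (\<alpha>\<^sup>2 v + y\<^sup>2 / v) / 2) dv\<close>. Tonelli then shows that the density has total mass
  one, and the Bessel relations become \<open>G\<^sub>s' = - y G\<^bsub>s-1\<^esub>\<close> and \<open>y\<^sup>2 G\<^bsub>s-1\<^esub> = \<alpha>\<^sup>2 G\<^bsub>s+1\<^esub> - 2 s G\<^sub>s\<close>. With them, the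
  density times the Stein operator applied to \<open>f\<close> is a total derivative of a function that is continuous
  and vanishes at both ends, which gives the expectation identity.

  Conversely, no moment of \<open>W\<close> is known in advance. The bounded rational test functions \<open>y / (1 + \<epsilon> y\<^sup>2)\<close>
  bound \<open>E (y\<^sup>2 / (1 + \<epsilon> y\<^sup>2))\<close> uniformly in \<open>\<epsilon>\<close>, so the second moment is finite. Then the test functions
  \<open>cos (t y)\<close> and \<open>sin (t y)\<close> are admissible and say that the characteristic function \<open>\<phi>\<close> of \<open>W - \<mu>\<close> solves
  \<open>\<phi>' D = - (\<nu> + 1/2) D' \<phi>\<close> with \<open>D(t) = \<gamma> + t\<^sup>2 - 2 i \<beta> t\<close>, whence \<open>\<phi> D\<^bsup>\<nu>+1/2\<^esup>\<close> is constant. By the first half the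
  variance-gamma law obeys the same equation, and Levy's uniqueness theorem applies.
\<close>

section \<open>Kernels of the generalized inverse Gaussian law\<close>

lemma has_bochner_integral_Gamma:
  fixes s a :: real
  assumes "s > 0" "a > 0"
  shows "has_bochner_integral lborel (\<lambda>v. if v > 0 then v powr (s - 1) * exp (- (a * v)) else 0)
           (Gamma s / a powr s)"
proof -
  have "has_bochner_integral lborel (\<lambda>t. indicator {0..} t * t powr (s - 1) / exp t) (Gamma s)"
    using Gamma_conv_nn_integral_real[OF assms(1)] assms(1)
    by (intro has_bochner_integral_nn_integral) (auto simp: Gamma_real_nonneg indicator_def)
  hence "has_bochner_integral lborel (\<lambda>t. indicator {0..} (0 + a * t) * (0 + a * t) powr (s - 1) / exp (0 + a * t))
          (Gamma s /\<^sub>R \<bar>a\<bar>)"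
    using assms(2) by (subst (asm) lborel_has_bochner_integral_real_affine_iff[of a _ _ 0]) auto
  hence "has_bochner_integral lborel (\<lambda>t. a powr (1 - s) * (indicator {0..} (0 + a * t) * (0 + a * t) powr (s - 1) / exp (0 + a * t)))
          (a powr (1 - s) * (Gamma s /\<^sub>R \<bar>a\<bar>))"
    by (rule has_bochner_integral_mult_right)
  moreover have "a powr (1 - s) * (Gamma s /\<^sub>R \<bar>a\<bar>) = Gamma s / a powr s"
    using assms(2) by (simp add: powr_diff field_simps)
  moreover have "a powr (1 - s) * (indicator {0..} (0 + a * t) * (0 + a * t) powr (s - 1) / exp (0 + a * t))
      = (if t > 0 then t powr (s - 1) * exp (- (a * t)) else 0)" for t
    using assms(2) by (auto simp: indicator_def powr_mult powr_diff exp_minus field_simps zero_le_mult_iff)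
  ultimately show ?thesis by simp
qed

text \<open>The density kernel of the generalized inverse Gaussian law; the variance-gamma law is the mixture
  of the normal laws with mean \<open>\<beta> v\<close> and variance \<open>v\<close> over such kernels.\<close>

definition gig :: "real \<Rightarrow> real \<Rightarrow> real \<Rightarrow> real \<Rightarrow> real" where
  "gig \<alpha> s x v = (if v > 0 then v powr (s - 1) * exp (- ((\<alpha>\<^sup>2 * v + x\<^sup>2 / v) / 2)) else 0)"

definition gig_int :: "real \<Rightarrow> real \<Rightarrow> real \<Rightarrow> real" where
  "gig_int \<alpha> s x = (\<integral>v. gig \<alpha> s x v \<partial>lborel)"

lemma gig_nonneg: "0 \<le> gig \<alpha> s x v"
  by (simp add: gig_def)

lemma gig_abs: "gig \<alpha> s \<bar>x\<bar> = gig \<alpha> s x"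
  by (simp add: gig_def fun_eq_iff)

lemma gig_int_nonneg: "0 \<le> gig_int \<alpha> s x"
  by (simp add: gig_int_def gig_nonneg)

lemma gig_measurable [measurable]: "gig \<alpha> s x \<in> borel_measurable borel"
  unfolding gig_def by measurable

section \<open>Integrability of the kernels in \<open>v\<close>\<close>

lemma integrable_gig_pos:
  assumes "s > 0" "\<alpha> > 0"
  shows "integrable lborel (gig \<alpha> s x)"
proof (rule Bochner_Integration.integrable_bound)
  show "integrable lborel (\<lambda>v. if v > 0 then v powr (s - 1) * exp (- ((\<alpha>\<^sup>2 / 2) * v)) else 0)"
    using has_bochner_integral_Gamma[of s "\<alpha>\<^sup>2 / 2"] assms by (auto simp: has_bochner_integral_iff)
  show "AE v in lborel. norm (gig \<alpha> s x v) \<le> norm (if v > 0 then v powr (s - 1) * exp (- ((\<alpha>\<^sup>2 / 2) * v)) else 0)"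
    by (auto simp: gig_def field_simps)
qed simp

text \<open>A single term of the exponential series bounds exp (b / v) from below. Since
  \<open>k\<close> is arbitrary, the factor exp (- b / v) can absorb any negative power of
  \<open>v\<close> at the origin.\<close>

lemma exp_minus_inverse_bound:
  fixes b v :: real
  assumes "b > 0" "v > 0"
  shows "exp (- (b / v)) \<le> fact k / b ^ k * v ^ k"
proof -
  have "(b / v) ^ k / fact k \<le> exp (b / v)"
  proof -
    have "(b / v) ^ k / fact k \<le> (\<Sum>n. (b / v) ^ n / fact n)"
      using assms summable_exp[of "b / v"]
      by (intro sum_le_suminf[of _ "{k}", simplified]) (auto simp: field_simps)
    thus ?thesis by (simp add: exp_def divide_inverse_commute)
  qed
  hence "1 \<le> exp (b / v) * (fact k / b ^ k * v ^ k)"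
    using assms by (simp add: field_simps power_divide)
  thus ?thesis by (simp add: exp_minus inverse_eq_divide pos_divide_le_eq mult.commute)
qed

text \<open>For x \<noteq> 0 the factor exp (- x^2 / (2 v)) beats the singularity of v^(s - 1) at v
  = 0, at the price of a constant. A large \<open>k\<close> reduces nonpositive orders to a Gamma
  integral.\<close>

lemma gig_le_shift:
  assumes "x \<noteq> 0"
  shows "gig \<alpha> s x v \<le> fact k / (x\<^sup>2 / 2) ^ k * gig \<alpha> (s + real k) 0 v"
proof (cases "v > 0")
  case True
  have "gig \<alpha> s x v = v powr (s - 1) * exp (- (\<alpha>\<^sup>2 * v / 2)) * exp (- ((x\<^sup>2 / 2) / v))"
    using True by (simp add: gig_def field_simps flip: exp_add)
  also have "\<dots> \<le> v powr (s - 1) * exp (- (\<alpha>\<^sup>2 * v / 2)) * (fact k / (x\<^sup>2 / 2) ^ k * v ^ k)"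
    using True assms by (intro mult_left_mono exp_minus_inverse_bound) auto
  also have "\<dots> = fact k / (x\<^sup>2 / 2) ^ k * gig \<alpha> (s + real k) 0 v"
    using True by (simp add: gig_def powr_add powr_diff powr_realpow mult_ac)
  finally show ?thesis .
qed (simp add: gig_def)

lemma integrable_gig:
  assumes "\<alpha> > 0" "x \<noteq> 0 \<or> s > 0"
  shows "integrable lborel (gig \<alpha> s x)"
proof (cases "s > 0")
  case False
  then have x: "x \<noteq> 0" using assms by auto
  obtain k :: nat where "- s < real k"
    using reals_Archimedean2[of "-s"] by auto
  then have k: "s + real k > 0" by linarith
  show ?thesis
  proof (rule Bochner_Integration.integrable_bound)
    show "integrable lborel (\<lambda>v. fact k / (x\<^sup>2 / 2) ^ k * gig \<alpha> (s + real k) 0 v)"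
      by (intro integrable_mult_right integrable_gig_pos k assms)
    show "AE v in lborel. norm (gig \<alpha> s x v) \<le> norm (fact k / (x\<^sup>2 / 2) ^ k * gig \<alpha> (s + real k) 0 v)"
      using gig_le_shift[OF x] by (intro AE_I2) (simp add: gig_nonneg zero_le_mult_iff)
  qed simp
qed (use assms integrable_gig_pos in auto)

section \<open>Differentiation under the integral sign and the Bessel relations\<close>

lemma has_vector_derivative_iff_quotient:
  "(f has_vector_derivative D) (at x within S) \<longleftrightarrow> ((\<lambda>y. (f y - f x) /\<^sub>R (y - x)) \<longlongrightarrow> D) (at x within S)"
proof -
  have "(f has_vector_derivative D) (at x within S) \<longleftrightarrow>
      ((\<lambda>y. norm ((f y - f x) - (y - x) *\<^sub>R D) / norm (y - x)) \<longlongrightarrow> 0) (at x within S)"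
    by (simp add: has_vector_derivative_def has_derivative_iff_norm bounded_linear_scaleR_left)
  also have "\<dots> \<longleftrightarrow> ((\<lambda>y. norm ((f y - f x) /\<^sub>R (y - x) - D)) \<longlongrightarrow> 0) (at x within S)"
  proof (intro filterlim_cong refl)
    have "norm ((f y - f x) - (y - x) *\<^sub>R D) / norm (y - x) = norm ((f y - f x) /\<^sub>R (y - x) - D)" if "y \<noteq> x" for y
    proof -
      have "(f y - f x) /\<^sub>R (y - x) - D = ((f y - f x) - (y - x) *\<^sub>R D) /\<^sub>R (y - x)"
        using that by (simp add: scaleR_diff_right)
      thus ?thesis by (simp add: divide_inverse_commute)
    qed
    thus "\<forall>\<^sub>F y in at x within S. norm ((f y - f x) - (y - x) *\<^sub>R D) / norm (y - x) = norm ((f y - f x) /\<^sub>R (y - x) - D)"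
      by (auto simp: eventually_at_filter)
  qed
  finally show ?thesis unfolding tendsto_norm_zero_iff LIM_zero_iff .
qed

text \<open>Dominated convergence is applied to the difference quotients along an arbitrary
  sequence; the mean value inequality on the convex set \<open>U\<close> bounds them by
  \<open>g\<close>. Banach space values cover both the real function \<open>gig_int\<close> and the
  complex characteristic function.\<close>

lemma has_vector_derivative_integral:
  fixes f f' :: "real \<Rightarrow> 'a \<Rightarrow> 'b::{banach,second_countable_topology}"
  assumes U: "open U" "convex U" "x0 \<in> U"
    and deriv: "\<And>x t. x \<in> U \<Longrightarrow> t \<in> space M \<Longrightarrow> ((\<lambda>x. f x t) has_vector_derivative f' x t) (at x)"
    and bound: "\<And>x t. x \<in> U \<Longrightarrow> t \<in> space M \<Longrightarrow> norm (f' x t) \<le> g t"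
    and int: "integrable M g" "\<And>x. x \<in> U \<Longrightarrow> integrable M (f x)"
    and meas: "f' x0 \<in> borel_measurable M"
  shows "((\<lambda>x. \<integral>t. f x t \<partial>M) has_vector_derivative (\<integral>t. f' x0 t \<partial>M)) (at x0)"
proof -
  have "((\<lambda>x. ((\<integral>t. f x t \<partial>M) - (\<integral>t. f x0 t \<partial>M)) /\<^sub>R (x - x0)) \<longlongrightarrow> (\<integral>t. f' x0 t \<partial>M)) (at x0 within U)"
    unfolding tendsto_at_iff_sequentially comp_def
  proof (intro allI impI)
    fix X :: "nat \<Rightarrow> real" assume X: "\<forall>i. X i \<in> U - {x0}" and lim: "X \<longlonglongrightarrow> x0"
    have "(\<lambda>i. \<integral>t. (f (X i) t - f x0 t) /\<^sub>R (X i - x0) \<partial>M) \<longlonglongrightarrow> (\<integral>t. f' x0 t \<partial>M)"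
    proof (rule integral_dominated_convergence[where w = g])
      show "(\<lambda>t. (f (X i) t - f x0 t) /\<^sub>R (X i - x0)) \<in> borel_measurable M" for i
        using int(2)[of "X i"] int(2)[of x0] U X
        by (intro borel_measurable_scaleR borel_measurable_diff borel_measurable_const borel_measurable_integrable) auto
      show "AE t in M. (\<lambda>i. (f (X i) t - f x0 t) /\<^sub>R (X i - x0)) \<longlonglongrightarrow> f' x0 t"
      proof (intro AE_I2)
        fix t assume t: "t \<in> space M"
        have "((\<lambda>x. (f x t - f x0 t) /\<^sub>R (x - x0)) \<longlongrightarrow> f' x0 t) (at x0 within U)"
          using has_vector_derivative_at_within[OF deriv[OF U(3) t], of U]
          by (simp add: has_vector_derivative_iff_quotient)
        thus "(\<lambda>i. (f (X i) t - f x0 t) /\<^sub>R (X i - x0)) \<longlonglongrightarrow> f' x0 t"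
          using X lim unfolding tendsto_at_iff_sequentially comp_def by blast
      qed
      show "AE t in M. norm ((f (X i) t - f x0 t) /\<^sub>R (X i - x0)) \<le> g t" for i
      proof (intro AE_I2)
        fix t assume t: "t \<in> space M"
        have "norm (f (X i) t - f x0 t) \<le> g t * norm (X i - x0)"
        proof (rule differentiable_bound[OF U(2)])
          show "((\<lambda>x. f x t) has_derivative (\<lambda>h. h *\<^sub>R f' x t)) (at x within U)" if "x \<in> U" for x
            using has_vector_derivative_at_within[OF deriv[OF that t]] by (simp add: has_vector_derivative_def)
          show "onorm (\<lambda>h. h *\<^sub>R f' x t) \<le> g t" if "x \<in> U" for x
            using bound[OF that t] by (intro onorm_le) (simp add: mult.commute[of "g t"] mult_left_mono)
        qed (use X U in auto)
        moreover have "X i \<noteq> x0" using X by auto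
        ultimately show "norm ((f (X i) t - f x0 t) /\<^sub>R (X i - x0)) \<le> g t"
          unfolding norm_scaleR by (simp add: field_simps)
      qed
    qed (use meas int in auto)
    moreover have "(\<integral>t. (f (X i) t - f x0 t) /\<^sub>R (X i - x0) \<partial>M) = ((\<integral>t. f (X i) t \<partial>M) - (\<integral>t. f x0 t \<partial>M)) /\<^sub>R (X i - x0)" for i
    proof -
      have "integrable M (f (X i))" "integrable M (f x0)" using int(2) U X by auto
      then show ?thesis by (subst integral_scaleR_right) (simp add: Bochner_Integration.integral_diff)
    qed
    ultimately show "(\<lambda>i. ((\<integral>t. f (X i) t \<partial>M) - (\<integral>t. f x0 t \<partial>M)) /\<^sub>R (X i - x0)) \<longlonglongrightarrow> (\<integral>t. f' x0 t \<partial>M)"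
      by (simp only:)
  qed
  thus ?thesis
    unfolding has_vector_derivative_iff_quotient at_within_open[OF U(3,1)] .
qed

text \<open>Differentiating exp (- y^2 / (2 v)) in y brings out the factor - y / v, which lowers the
  order of the kernel by one.\<close>

lemma gig_int_has_real_derivative:
  assumes "\<alpha> > 0" "x \<noteq> 0"
  shows "(gig_int \<alpha> s has_real_derivative - (x * gig_int \<alpha> (s - 1) x)) (at x)"
proof -
  have "((\<lambda>y. \<integral>v. gig \<alpha> s y v \<partial>lborel) has_vector_derivative
          (\<integral>v. - (x * gig \<alpha> (s - 1) x v) \<partial>lborel)) (at x)"
  proof (rule has_vector_derivative_integral[where U = "ball x (\<bar>x\<bar> / 2)"])
    fix y v :: real
    \<comment> \<open>The radius keeps |y| between |x| / 2 and 2 |x|. As the kernel does not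
      increase with |y|, its value at x / 2 times 2 |x| dominates the derivative on the whole
      ball.\<close>
    assume "y \<in> ball x (\<bar>x\<bar> / 2)"
    then have "\<bar>x - y\<bar> < \<bar>x\<bar> / 2" by (simp add: dist_real_def)
    then have y: "\<bar>x\<bar> / 2 \<le> \<bar>y\<bar>" "\<bar>y\<bar> \<le> 2 * \<bar>x\<bar>" by linarith+
    show "((\<lambda>y. gig \<alpha> s y v) has_vector_derivative - (y * gig \<alpha> (s - 1) y v)) (at y)"
    proof (cases "v > 0")
      case True
      have "((\<lambda>y. v powr (s - 1) * exp (- ((\<alpha>\<^sup>2 * v + y\<^sup>2 / v) / 2))) has_real_derivative
          v powr (s - 1) * (exp (- ((\<alpha>\<^sup>2 * v + y\<^sup>2 / v) / 2)) * (- (y / v)))) (at y)"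
        using True by (auto intro!: derivative_eq_intros)
      moreover have "v powr (s - 1) * (exp (- ((\<alpha>\<^sup>2 * v + y\<^sup>2 / v) / 2)) * (- (y / v))) = - (y * gig \<alpha> (s - 1) y v)"
        using True by (simp add: gig_def powr_diff power2_eq_square)
      ultimately show ?thesis
        using True by (simp add: gig_def has_real_derivative_iff_has_vector_derivative)
    qed (simp add: gig_def)
    have "(x / 2)\<^sup>2 \<le> y\<^sup>2"
      using y(1) abs_le_square_iff[of "x / 2" y] by simp
    then have "gig \<alpha> (s - 1) y v \<le> gig \<alpha> (s - 1) (x / 2) v"
      by (auto simp: gig_def divide_right_mono)
    then show "norm (- (y * gig \<alpha> (s - 1) y v)) \<le> 2 * \<bar>x\<bar> * gig \<alpha> (s - 1) (x / 2) v"
      using y(2) by (auto simp: abs_mult gig_nonneg intro!: mult_mono)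
    show "integrable lborel (gig \<alpha> s y)"
      using y(1) assms by (intro integrable_gig) auto
  next
    show "integrable lborel (\<lambda>v. 2 * \<bar>x\<bar> * gig \<alpha> (s - 1) (x / 2) v)"
      using assms by (intro integrable_mult_right integrable_gig) auto
  qed (use assms in auto)
  then show ?thesis
    by (simp add: gig_int_def[abs_def] has_real_derivative_iff_has_vector_derivative)
qed

text \<open>This is the three-term recurrence of the Bessel functions. It comes from integrating the
  derivative of v^s exp (- (\<alpha>^2 v + x^2 / v) / 2) over v > 0; since \<alpha> and x are
  nonzero, the boundary values at 0 and at infinity vanish for every real s.\<close>

lemma gig_int_recurrence:
  assumes "\<alpha> > 0" "x \<noteq> 0"
  shows "x\<^sup>2 * gig_int \<alpha> (s - 1) x = \<alpha>\<^sup>2 * gig_int \<alpha> (s + 1) x - 2 * s * gig_int \<alpha> s x"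
proof -
  define F where "F = (\<lambda>v. v powr s * exp (- ((\<alpha>\<^sup>2 * v + x\<^sup>2 / v) / 2)))"
  define f where "f = (\<lambda>v. s * gig \<alpha> s x v - \<alpha>\<^sup>2 / 2 * gig \<alpha> (s + 1) x v + x\<^sup>2 / 2 * gig \<alpha> (s - 1) x v)"
  have int: "integrable lborel (gig \<alpha> r x)" for r
    using assms by (intro integrable_gig) auto
  have pos: "\<alpha>\<^sup>2 > 0" "x\<^sup>2 > 0" using assms by auto
  have "(LBINT v=ereal 0..\<infinity>. f v) = 0 - 0"
  proof (rule interval_integral_FTC_integrable[where F = F])
    fix v :: real assume "ereal 0 < ereal v"
    then have v: "v > 0" by simp
    have 1: "(F has_real_derivative (s * v powr (s - 1)) * exp (- ((\<alpha>\<^sup>2 * v + x\<^sup>2 / v) / 2))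
        + exp (- ((\<alpha>\<^sup>2 * v + x\<^sup>2 / v) / 2)) * (- ((\<alpha>\<^sup>2 - x\<^sup>2 / v\<^sup>2) / 2)) * v powr s) (at v)"
      unfolding F_def using v by (auto intro!: derivative_eq_intros simp: power2_eq_square)
    have 2: "(s * v powr (s - 1)) * exp (- ((\<alpha>\<^sup>2 * v + x\<^sup>2 / v) / 2))
        + exp (- ((\<alpha>\<^sup>2 * v + x\<^sup>2 / v) / 2)) * (- ((\<alpha>\<^sup>2 - x\<^sup>2 / v\<^sup>2) / 2)) * v powr s = f v"
      using v by (simp add: f_def gig_def powr_diff field_simps power2_eq_square)
    show "(F has_vector_derivative f v) (at v)"
      using 1 unfolding 2 by (simp add: has_real_derivative_iff_has_vector_derivative)
    have ev: "\<forall>\<^sub>F w in nhds v. w > 0" using v by (simp add: eventually_nhds_in_open[of "{0<..}", simplified])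
    have c: "isCont (gig \<alpha> r x) v" for r
    proof -
      have "isCont (\<lambda>v. v powr (r - 1) * exp (- ((\<alpha>\<^sup>2 * v + x\<^sup>2 / v) / 2))) v"
        using v by (intro continuous_intros) auto
      also have "?this \<longleftrightarrow> ?thesis"
        by (rule isCont_cong) (use ev in eventually_elim, simp add: gig_def)
      finally show ?thesis .
    qed
    show "isCont f v" unfolding f_def by (intro continuous_intros c)
  next
    have "(F \<longlongrightarrow> 0) (at_right 0)" unfolding F_def using pos by real_asymp
    then show "((F \<circ> real_of_ereal) \<longlongrightarrow> 0) (at_right (ereal 0))" by (simp add: ereal_tendsto_simps)
    have "(F \<longlongrightarrow> 0) at_top" unfolding F_def using pos by real_asymp
    then show "((F \<circ> real_of_ereal) \<longlongrightarrow> 0) (at_left \<infinity>)" by (simp add: ereal_tendsto_simps)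
    have "integrable lborel f" unfolding f_def by (intro Bochner_Integration.integrable_diff Bochner_Integration.integrable_add integrable_mult_right int)
    then show "set_integrable lborel (einterval (ereal 0) \<infinity>) f"
      unfolding set_integrable_def by (intro integrable_mult_indicator) auto
  qed simp
  moreover have "(LBINT v=ereal 0..\<infinity>. f v) = (\<integral>v. f v \<partial>lborel)"
    by (auto simp: interval_lebesgue_integral_def set_lebesgue_integral_def einterval_def f_def gig_def indicator_def
        intro!: Bochner_Integration.integral_cong)
  ultimately have "(\<integral>v. f v \<partial>lborel) = 0" by simp
  then show ?thesis
    unfolding f_def by (simp add: int gig_int_def)
qed

section \<open>Continuity in the argument and decay at infinity\<close>

lemma isCont_integral:
  fixes f :: "real \<Rightarrow> 'a \<Rightarrow> real"
  assumes "\<And>x. f x \<in> borel_measurable M"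
    and "\<And>t. t \<in> space M \<Longrightarrow> isCont (\<lambda>x. f x t) a"
    and "integrable M g" "\<And>x t. t \<in> space M \<Longrightarrow> norm (f x t) \<le> g t"
  shows "isCont (\<lambda>x. \<integral>t. f x t \<partial>M) a"
  unfolding continuous_at_sequentially comp_def
proof (intro allI impI)
  fix X :: "nat \<Rightarrow> real" assume X: "X \<longlonglongrightarrow> a"
  show "(\<lambda>i. \<integral>t. f (X i) t \<partial>M) \<longlonglongrightarrow> (\<integral>t. f a t \<partial>M)"
    by (rule integral_dominated_convergence[where w = g])
       (use assms X in \<open>auto simp: continuous_at_sequentially comp_def\<close>)
qed

lemma isCont_gig: "isCont (\<lambda>x. gig \<alpha> s x v) a"
  unfolding gig_def by (cases "v > 0") (auto intro!: continuous_intros)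

lemma isCont_gig_int:
  assumes "\<alpha> > 0" "s > 0"
  shows "isCont (gig_int \<alpha> s) x"
  unfolding gig_int_def[abs_def]
proof (rule isCont_integral)
  show "integrable lborel (gig \<alpha> s 0)" using assms by (intro integrable_gig) auto
qed (auto simp: isCont_gig, auto simp: gig_def divide_right_mono)

text \<open>For s \<le> 0 the integral itself diverges at x = 0, and the factor x repairs this. With
  y = |x| / sqrt v, the boundedness of y exp (- y^2 / 2) trades |x| for v^(1/2), so a kernel of the
  positive order s + 1/2 dominates.\<close>

lemma isCont_mult_gig_int_0:
  assumes "\<alpha> > 0" "s > - 1/2"
  shows "isCont (\<lambda>x. x * gig_int \<alpha> s x) 0"
proof -
  have "isCont (\<lambda>x. \<integral>v. x * gig \<alpha> s x v \<partial>lborel) 0"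
  proof (rule isCont_integral)
    show "integrable lborel (gig \<alpha> (s + 1/2) 0)" using assms by (intro integrable_gig) auto
    fix x v :: real
    show "norm (x * gig \<alpha> s x v) \<le> gig \<alpha> (s + 1/2) 0 v"
    proof (cases "v > 0")
      case True
      define y where "y = \<bar>x\<bar> / sqrt v"
      have x: "\<bar>x\<bar> = y * v powr (1/2)" "x\<^sup>2 = y\<^sup>2 * v"
        using True by (auto simp: y_def powr_half_sqrt power_divide)
      have "0 \<le> (y - 1)\<^sup>2" by simp
      then have "y \<le> 1 + y\<^sup>2 / 2" by (simp add: power2_eq_square algebra_simps) 
      also have "\<dots> \<le> exp (y\<^sup>2 / 2)" by (rule exp_ge_add_one_self)
      finally have y: "y * exp (- (y\<^sup>2 / 2)) \<le> 1" by (simp add: exp_minus field_simps)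
      have "norm (x * gig \<alpha> s x v) = (y * exp (- (y\<^sup>2 / 2))) * (v powr (1/2) * v powr (s - 1) * exp (- (\<alpha>\<^sup>2 * v / 2)))"
        using True by (simp add: abs_mult gig_nonneg) (simp add: gig_def x field_simps flip: exp_add)
      also have "\<dots> \<le> 1 * (v powr (1/2) * v powr (s - 1) * exp (- (\<alpha>\<^sup>2 * v / 2)))"
        by (intro mult_right_mono y) auto
      also have "\<dots> = gig \<alpha> (s + 1/2) 0 v"
        using True by (simp add: gig_def add_ac flip: powr_add)
      finally show ?thesis .
    qed (simp add: gig_def)
  qed (auto intro!: continuous_intros isCont_gig)
  then show ?thesis by (simp add: gig_int_def)
qed

text \<open>After the scaling v = |x| w the exponent is - |x| q(w) with q(w) = (\<alpha>^2 w + 1 /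
  w) / 2 \<ge> \<alpha> by the inequality of arithmetic and geometric means. One copy of exp (-
  q(w)) is kept for integrability; the other |x| - 1 copies are bounded by exp (- \<alpha> (|x| -
  1)). The power |x|^s is half a power above the true asymptotics, which the growth conditions can
  afford.\<close>

lemma gig_int_le:
  assumes "\<alpha> > 0" "\<bar>x\<bar> \<ge> 1"
  shows "gig_int \<alpha> s x \<le> exp \<alpha> * gig_int \<alpha> s 1 * \<bar>x\<bar> powr s * exp (- (\<alpha> * \<bar>x\<bar>))"
proof -
  define y where "y = \<bar>x\<bar>"
  have y: "y \<ge> 1" using assms by (simp add: y_def)
  have "gig_int \<alpha> s x = (\<integral>v. gig \<alpha> s y v \<partial>lborel)" by (simp add: gig_int_def y_def gig_abs)
  also have "\<dots> = y * (\<integral>w. gig \<alpha> s y (y * w) \<partial>lborel)"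
    using y by (subst lborel_integral_real_affine[where c = y and t = 0]) auto
  also have "\<dots> \<le> y * (\<integral>w. (y powr (s - 1) * exp \<alpha> * exp (- (\<alpha> * y))) * gig \<alpha> s 1 w \<partial>lborel)"
  proof (intro mult_left_mono integral_mono)
    have "integrable lborel (\<lambda>w. gig \<alpha> s y (0 + y * w))"
      using y assms by (intro lborel_integrable_real_affine integrable_gig) auto
    then show "integrable lborel (\<lambda>w. gig \<alpha> s y (y * w))" by simp
    show "integrable lborel (\<lambda>w. (y powr (s - 1) * exp \<alpha> * exp (- (\<alpha> * y))) * gig \<alpha> s 1 w)"
      using assms by (intro integrable_mult_right integrable_gig) auto
    fix w :: real
    show "gig \<alpha> s y (y * w) \<le> (y powr (s - 1) * exp \<alpha> * exp (- (\<alpha> * y))) * gig \<alpha> s 1 w"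
    proof (cases "w > 0")
      case True
      define q where "q = (\<alpha>\<^sup>2 * w + 1 / w) / 2"
      have "0 \<le> (\<alpha> * w - 1)\<^sup>2 / (2 * w)" using True by auto
      also have "\<dots> = q - \<alpha>" using True by (simp add: q_def field_simps power2_eq_square)
      finally have "0 \<le> (y - 1) * (q - \<alpha>)" using y by simp
      then have "- (y * q) \<le> \<alpha> - \<alpha> * y - q" by (simp add: algebra_simps)
      then have "exp (- (y * q)) \<le> exp \<alpha> * exp (- (\<alpha> * y)) * exp (- q)" by (simp flip: exp_add)
      then have "y powr (s - 1) * w powr (s - 1) * exp (- (y * q)) \<le>
          y powr (s - 1) * w powr (s - 1) * (exp \<alpha> * exp (- (\<alpha> * y)) * exp (- q))"
        by (intro mult_left_mono) auto
      moreover have "gig \<alpha> s y (y * w) = y powr (s - 1) * w powr (s - 1) * exp (- (y * q))"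
        using True y by (simp add: gig_def q_def powr_mult field_simps power2_eq_square)
      moreover have "gig \<alpha> s 1 w = w powr (s - 1) * exp (- q)"
        using True by (simp add: gig_def q_def)
      ultimately show ?thesis by (simp add: mult_ac)
    next
      case False
      then show ?thesis using y by (auto simp: gig_def zero_less_mult_iff)
    qed
  qed (use y in auto)
  also have "\<dots> = exp \<alpha> * gig_int \<alpha> s 1 * \<bar>x\<bar> powr s * exp (- (\<alpha> * \<bar>x\<bar>))"
    using y by (simp add: gig_int_def powr_diff y_def)
  finally show ?thesis .
qed

text \<open>With v = (|x| / \<alpha>) exp t the exponent becomes - \<alpha> |x| cosh t, which is
  even in t. Averaging over t and - t turns exp (s t) into cosh (s t), and folding the line gives
  the factor 2.\<close>

lemma gig_int_eq_bessel_K: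
  assumes "\<alpha> > 0" "x \<noteq> 0"
  shows "gig_int \<alpha> s x = 2 * (\<bar>x\<bar> / \<alpha>) powr s * bessel_K s (\<alpha> * \<bar>x\<bar>)"
proof -
  define c where "c = \<bar>x\<bar> / \<alpha>"
  have c: "c > 0" "\<alpha>\<^sup>2 * c = \<alpha> * \<bar>x\<bar>" "x\<^sup>2 / c = \<alpha> * \<bar>x\<bar>"
    using assms by (auto simp: c_def power2_eq_square field_simps)
  define h where "h = (\<lambda>t. c powr s * (exp (s * t) * exp (- (\<alpha> * \<bar>x\<bar> * cosh t))))"
  have h: "\<bar>c * exp t\<bar> * gig \<alpha> s x (c * exp t) = h t" for t
  proof -
    have "(\<alpha>\<^sup>2 * (c * exp t) + x\<^sup>2 / (c * exp t)) / 2 = \<alpha> * \<bar>x\<bar> * cosh t"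
    proof -
      have "(\<alpha>\<^sup>2 * (c * exp t) + x\<^sup>2 / (c * exp t)) / 2 = ((\<alpha>\<^sup>2 * c) * exp t + (x\<^sup>2 / c) * exp (- t)) / 2"
        by (simp add: exp_minus field_simps)
      also have "\<dots> = \<alpha> * \<bar>x\<bar> * cosh t" unfolding c(2,3) by (simp add: cosh_def field_simps)
      finally show ?thesis .
    qed
    then show ?thesis
      using c(1) by (simp add: gig_def h_def powr_diff powr_mult powr_def[of "exp t"] mult_ac)
  qed
  have int: "integrable lborel (gig \<alpha> s x)" using assms by (intro integrable_gig) auto
  have img: "(\<lambda>t. c * exp t) ` UNIV = {0<..}"
  proof -
    have "v \<in> (\<lambda>t. c * exp t) ` UNIV" if "v > 0" for v
      using c(1) that by (intro image_eqI[of _ _ "ln (v / c)"]) auto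
    then show ?thesis using c(1) by auto
  qed
  have supp: "indicator {0<..} v *\<^sub>R gig \<alpha> s x v = gig \<alpha> s x v" for v
    by (simp add: gig_def indicator_def)
  \<comment> \<open>The change of variables theorem speaks of \<open>lebesgue\<close> and the gauge
    integral, hence the passage from \<open>lborel\<close> to its completion here and back
    below.\<close>
  have "gig \<alpha> s x absolutely_integrable_on {0<..}"
    unfolding set_integrable_def supp using int by (simp add: integrable_completion)
  moreover have "integral {0<..} (gig \<alpha> s x) = gig_int \<alpha> s x"
  proof -
    have "(gig \<alpha> s x has_integral gig_int \<alpha> s x) UNIV"
      using int unfolding gig_int_def by (rule has_integral_integral_lborel)
    then have "((\<lambda>v. if v \<in> {0<..} then gig \<alpha> s x v else 0) has_integral gig_int \<alpha> s x) UNIV"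
      by (rule has_integral_eq[rotated]) (auto simp: gig_def)
    then show ?thesis by (subst (asm) has_integral_restrict_UNIV) (auto simp: integral_unique)
  qed
  moreover have "inj (\<lambda>t. c * exp t)" using c(1) by (auto intro!: injI)
  moreover have "((\<lambda>t. c * exp t) has_field_derivative c * exp t) (at t)" for t
    by (auto intro!: derivative_eq_intros)
  ultimately have "h absolutely_integrable_on UNIV" and hint: "integral UNIV h = gig_int \<alpha> s x"
    using has_absolute_integral_change_of_variables_1'[of UNIV "\<lambda>t. c * exp t" "\<lambda>t. c * exp t" "gig \<alpha> s x" "gig_int \<alpha> s x"]
    by (auto simp: h img)
  moreover have hm: "h \<in> borel_measurable borel"
    unfolding h_def by (intro borel_measurable_continuous_onI continuous_intros)
  ultimately have "integrable lborel h"
    using integrable_completion[of h lborel] hm by (simp add: set_integrable_def)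
  then have h1: "has_bochner_integral lborel h (gig_int \<alpha> s x)"
    using hint by (simp add: has_bochner_integral_iff integral_lborel)
  have h2: "has_bochner_integral lborel (\<lambda>t. h (- t)) (gig_int \<alpha> s x)"
    using h1 lborel_has_bochner_integral_real_affine_iff[of "-1" h "gig_int \<alpha> s x" 0] by simp
  define e where "e = (\<lambda>t. 2 * c powr s * (exp (- (\<alpha> * \<bar>x\<bar> * cosh t)) * cosh (s * t)))"
  have "(\<lambda>t. h t + h (- t)) = e"
    by (auto simp: fun_eq_iff h_def e_def cosh_def field_simps)
  then have e: "has_bochner_integral lborel e (gig_int \<alpha> s x + gig_int \<alpha> s x)"
    using has_bochner_integral_add[OF h1 h2] by simp
  have "has_bochner_integral lborel (\<lambda>t. indicator {0..} t *\<^sub>R e t) (2 * c powr s * bessel_K s (\<alpha> * \<bar>x\<bar>))"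
  proof -
    have "integrable lborel (\<lambda>t. indicator {0..} t *\<^sub>R e t)"
      using e by (intro integrable_mult_indicator) (auto simp: has_bochner_integral_iff)
    moreover have "indicator {0..} t *\<^sub>R e t = 2 * c powr s * (indicator {0..} t *\<^sub>R (exp (- (\<alpha> * \<bar>x\<bar>) * cosh t) * cosh (s * t)))" for t
      by (simp add: e_def)
    ultimately show ?thesis
      unfolding has_bochner_integral_iff bessel_K_def set_lebesgue_integral_def
      by (simp only: integral_mult_right_zero simp_thms)
  qed
  \<comment> \<open>The integral of \<open>e\<close> over the line is now known twice: as two copies
    of \<open>gig_int\<close>, and as twice its integral over the half-line.\<close>
  from has_bochner_integral_even_function[OF this]
  have "has_bochner_integral lborel e (2 *\<^sub>R (2 * c powr s * bessel_K s (\<alpha> * \<bar>x\<bar>)))"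
    by (simp add: e_def)
  with e show ?thesis by (auto simp: c_def dest: has_bochner_integral_eq)
qed

section \<open>The variance-gamma density as a normal mixture\<close>

lemma bessel_K_measurable [measurable]: "bessel_K \<nu> \<in> borel_measurable borel"
proof -
  have [measurable]: "cosh \<in> borel_measurable (borel :: real measure)"
    by (intro borel_measurable_continuous_onI continuous_intros)
  show ?thesis
    unfolding bessel_K_def set_lebesgue_integral_def by measurable
qed

locale VG2_params =
  fixes \<nu> \<alpha> \<beta> \<mu> :: real
  assumes \<nu>: "\<nu> > - 1/2" and \<alpha>\<beta>: "\<alpha> > \<bar>\<beta>\<bar>"
begin

definition \<gamma> :: real where "\<gamma> = \<alpha>\<^sup>2 - \<beta>\<^sup>2"

text \<open>The power of 1/2 collects the 2^(- \<nu>) from (|x - \<mu>| / (2 \<alpha>))^\<nu> and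
  the factor 2 in \<open>gig_int_eq_bessel_K\<close>.\<close>

definition C :: real where "C = \<gamma> powr (\<nu> + 1/2) / (sqrt pi * Gamma (\<nu> + 1/2)) * (1/2) powr (\<nu> + 1)"

abbreviation p :: "real \<Rightarrow> real" where "p \<equiv> VG2_density \<nu> \<alpha> \<beta> \<mu>"

lemma \<alpha>_pos: "\<alpha> > 0"
  using \<alpha>\<beta> by linarith

lemma \<gamma>_pos: "\<gamma> > 0"
proof -
  have "\<bar>\<beta>\<bar>\<^sup>2 < \<alpha>\<^sup>2" using \<alpha>\<beta> by (intro power_strict_mono) auto
  then show ?thesis by (simp add: \<gamma>_def)
qed

lemma C_pos: "C > 0"
  using \<gamma>_pos \<nu> by (simp add: C_def Gamma_real_pos)

text \<open>The point \<mu> is excluded: there the density is 0 because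
  \<open>0 powr \<nu> = 0\<close>, whereas \<open>gig_int\<close> is positive at 0 for \<nu> >
  0.\<close>

lemma VG2_density_eq:
  assumes "x \<noteq> \<mu>"
  shows "p x = C * exp (\<beta> * (x - \<mu>)) * gig_int \<alpha> \<nu> (x - \<mu>)"
proof -
  define y where "y = x - \<mu>"
  have y: "y \<noteq> 0" using assms by (simp add: y_def)
  have "(\<bar>y\<bar> / (2 * \<alpha>)) powr \<nu> = (1/2 * (\<bar>y\<bar> / \<alpha>)) powr \<nu>" by simp
  also have "\<dots> = (1/2) powr \<nu> * (\<bar>y\<bar> / \<alpha>) powr \<nu>" using \<alpha>_pos by (subst powr_mult) auto
  finally have 1: "(\<bar>y\<bar> / (2 * \<alpha>)) powr \<nu> = (1/2) powr \<nu> * (\<bar>y\<bar> / \<alpha>) powr \<nu>" .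
  have 2: "(1/2::real) powr (\<nu> + 1) = (1/2) powr \<nu> / 2" by (simp add: powr_add)
  show ?thesis
    unfolding VG2_density_def C_def \<gamma>_def y_def[symmetric] gig_int_eq_bessel_K[OF \<alpha>_pos y] 1 2
    by simp
qed

lemma VG2_density_measurable [measurable]: "p \<in> borel_measurable borel"
  unfolding VG2_density_def by measurable

lemma VG2_density_nonneg: "0 \<le> p x"
proof -
  have "0 \<le> bessel_K \<nu> y" for y
    unfolding bessel_K_def set_lebesgue_integral_def by (intro integral_nonneg_AE) auto
  then show ?thesis
    using \<nu> by (auto simp: VG2_density_def Gamma_real_nonneg intro!: mult_nonneg_nonneg)
qed

lemma AE_neq_\<mu>: "AE x in lborel. x \<noteq> \<mu>"
  by (rule AE_lborel_singleton)

text \<open>Completing the square in x - \<mu> splits off a normal law with mean \<mu> + \<beta> v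
  and variance v, and leaves exp (- \<gamma> v / 2). The normalisation of the normal law contributes
  the half power of v that turns the order \<nu> into the gamma shape \<nu> + 1/2.\<close>

lemma exp_gig_eq_normal_density:
  assumes "v > 0"
  shows "exp (\<beta> * (x - \<mu>)) * gig \<alpha> \<nu> (x - \<mu>) v =
    sqrt (2 * pi) * (v powr ((\<nu> + 1/2) - 1) * exp (- (\<gamma> / 2 * v))) * normal_density (\<mu> + \<beta> * v) (sqrt v) x"
proof -
  define y where "y = x - \<mu>"
  have e: "\<beta> * y - (\<alpha>\<^sup>2 * v + y\<^sup>2 / v) / 2 = - (\<gamma> / 2 * v) - (y - \<beta> * v)\<^sup>2 / (2 * v)"
    using assms by (simp add: \<gamma>_def field_simps power2_eq_square)
  have s: "v powr (\<nu> - 1) = sqrt (2 * pi) * v powr ((\<nu> + 1/2) - 1) / sqrt (2 * pi * v)"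
  proof -
    have "v powr (1/2) * v powr (1/2) = v" using assms by (simp flip: powr_add)
    then show ?thesis
      using assms by (simp add: real_sqrt_mult powr_half_sqrt[symmetric] powr_add powr_diff)
  qed
  have "exp (\<beta> * y) * gig \<alpha> \<nu> y v = v powr (\<nu> - 1) * (exp (\<beta> * y) * exp (- ((\<alpha>\<^sup>2 * v + y\<^sup>2 / v) / 2)))"
    using assms by (simp add: gig_def)
  also have "\<dots> = v powr (\<nu> - 1) * exp (\<beta> * y - (\<alpha>\<^sup>2 * v + y\<^sup>2 / v) / 2)"
    by (simp flip: exp_add)
  also have "\<dots> = v powr (\<nu> - 1) * (exp (- (\<gamma> / 2 * v)) * exp (- ((y - \<beta> * v)\<^sup>2 / (2 * v))))"
    unfolding e by (simp flip: exp_add)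
  also have "\<dots> = sqrt (2 * pi) * (v powr ((\<nu> + 1/2) - 1) * exp (- (\<gamma> / 2 * v))) * normal_density (\<mu> + \<beta> * v) (sqrt v) x"
    unfolding s using assms by (simp add: normal_density_def y_def algebra_simps)
  finally show ?thesis by (simp add: y_def)
qed

lemma nn_integral_VG2_density: "(\<integral>\<^sup>+x. ennreal (p x) \<partial>lborel) = 1"
proof -
  define k where "k = (\<lambda>x v. C * exp (\<beta> * (x - \<mu>)) * gig \<alpha> \<nu> (x - \<mu>) v)"
  define m where "m = (\<lambda>v. if v > 0 then v powr ((\<nu> + 1/2) - 1) * exp (- (\<gamma> / 2 * v)) else 0)"
  have [measurable]: "(\<lambda>(x, v). k x v) \<in> borel_measurable (borel \<Otimes>\<^sub>M borel)"
    unfolding k_def gig_def by measurable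
  have "(\<integral>\<^sup>+x. ennreal (p x) \<partial>lborel) = (\<integral>\<^sup>+x. (\<integral>\<^sup>+v. ennreal (k x v) \<partial>lborel) \<partial>lborel)"
  proof (rule nn_integral_cong_AE, use AE_neq_\<mu> in eventually_elim)
    fix x assume x: "x \<noteq> \<mu>"
    then have "integrable lborel (k x)"
      unfolding k_def using \<alpha>_pos by (intro integrable_mult_right integrable_gig) auto
    then have "(\<integral>\<^sup>+v. ennreal (k x v) \<partial>lborel) = ennreal (\<integral>v. k x v \<partial>lborel)"
      using C_pos by (intro nn_integral_eq_integral) (auto simp: k_def gig_nonneg)
    then show "ennreal (p x) = (\<integral>\<^sup>+v. ennreal (k x v) \<partial>lborel)"
      using x by (simp add: k_def VG2_density_eq gig_int_def)
  qed
  also have "\<dots> = (\<integral>\<^sup>+v. (\<integral>\<^sup>+x. ennreal (k x v) \<partial>lborel) \<partial>lborel)"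
    by (rule lborel_pair.Fubini') simp
  also have "\<dots> = (\<integral>\<^sup>+v. ennreal (C * sqrt (2 * pi) * m v) \<partial>lborel)"
  proof (rule nn_integral_cong)
    fix v :: real
    show "(\<integral>\<^sup>+x. ennreal (k x v) \<partial>lborel) = ennreal (C * sqrt (2 * pi) * m v)"
    proof (cases "v > 0")
      case True
      have c: "C * sqrt (2 * pi) * m v \<ge> 0" using C_pos by (simp add: m_def)
      have "k x v = (C * sqrt (2 * pi) * m v) * normal_density (\<mu> + \<beta> * v) (sqrt v) x" for x
        using exp_gig_eq_normal_density[OF True, of x] True by (simp add: k_def m_def mult.assoc)
      then have "(\<integral>\<^sup>+x. ennreal (k x v) \<partial>lborel) =
          ennreal (C * sqrt (2 * pi) * m v) * (\<integral>\<^sup>+x. normal_density (\<mu> + \<beta> * v) (sqrt v) x \<partial>lborel)"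
        using c by (simp add: ennreal_mult nn_integral_cmult)
      also have "(\<integral>\<^sup>+x. normal_density (\<mu> + \<beta> * v) (sqrt v) x \<partial>lborel) = 1"
        using True by (subst nn_integral_eq_integral) auto
      finally show ?thesis by simp
    qed (simp add: k_def m_def gig_def)
  qed
  also have "\<dots> = ennreal (C * sqrt (2 * pi) * (Gamma (\<nu> + 1/2) / (\<gamma> / 2) powr (\<nu> + 1/2)))"
  proof -
    have "has_bochner_integral lborel m (Gamma (\<nu> + 1/2) / (\<gamma> / 2) powr (\<nu> + 1/2))"
      unfolding m_def using \<gamma>_pos \<nu> by (intro has_bochner_integral_Gamma) auto
    then have "has_bochner_integral lborel (\<lambda>v. C * sqrt (2 * pi) * m v)
        (C * sqrt (2 * pi) * (Gamma (\<nu> + 1/2) / (\<gamma> / 2) powr (\<nu> + 1/2)))"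
      by (rule has_bochner_integral_mult_right)
    then show ?thesis
      using C_pos by (subst nn_integral_eq_integral) (auto simp: has_bochner_integral_iff m_def)
  qed
  also have "C * sqrt (2 * pi) * (Gamma (\<nu> + 1/2) / (\<gamma> / 2) powr (\<nu> + 1/2)) = 1"
  proof -
    have g: "Gamma (\<nu> + 1/2) \<noteq> 0" using Gamma_real_pos[of "\<nu> + 1/2"] \<nu> by linarith
    \<comment> \<open>One half power cancels the sqrt 2 in sqrt (2 pi); the remaining (1/2)^(\<nu> +
      1/2) cancels the one in (\<gamma> / 2)^(\<nu> + 1/2).\<close>
    have "(1/2::real) powr (\<nu> + 1) = (1/2) powr (\<nu> + 1/2) / sqrt 2"
    proof -
      have "(1/2::real) powr (\<nu> + 1) = (1/2) powr ((\<nu> + 1/2) + 1/2)" by (simp add: add.assoc)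
      also have "\<dots> = (1/2) powr (\<nu> + 1/2) * (1/2) powr (1/2)" by (rule powr_add)
      also have "(1/2::real) powr (1/2) = 1 / sqrt 2" by (simp add: powr_half_sqrt real_sqrt_divide)
      finally show ?thesis by simp
    qed
    moreover have "(\<gamma> / 2) powr (\<nu> + 1/2) = \<gamma> powr (\<nu> + 1/2) * (1/2) powr (\<nu> + 1/2)"
      using powr_mult[of \<gamma> "1/2" "\<nu> + 1/2"] \<gamma>_pos by simp
    ultimately show ?thesis
      using g \<gamma>_pos by (simp add: C_def real_sqrt_mult)
  qed
  finally show ?thesis by simp
qed

lemma prob_space_VG2: "prob_space (density lborel (\<lambda>x. ennreal (p x)))"
  by (intro prob_spaceI) (simp add: emeasure_density nn_integral_VG2_density)

end

section \<open>The Stein identity\<close>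

context VG2_params
begin

text \<open>The boundary term of the integration by parts against the density: the derivative of
  \<open>stein_primitive f\<close> is the density times the Stein operator applied to \<open>f\<close>. It is written with orders \<open>\<nu>\<close> and \<open>\<nu> + 1\<close>
  only, so that it extends continuously across \<open>x = \<mu>\<close>, where the density itself may be singular.\<close>

definition stein_primitive :: "(real \<Rightarrow> real) \<Rightarrow> real \<Rightarrow> real" where
  "stein_primitive f x = C * exp (\<beta> * (x - \<mu>)) *
     (((x - \<mu>) * gig_int \<alpha> \<nu> (x - \<mu>)) * deriv f x
      + (\<beta> * ((x - \<mu>) * gig_int \<alpha> \<nu> (x - \<mu>)) + \<alpha>\<^sup>2 * gig_int \<alpha> (\<nu> + 1) (x - \<mu>)) * f x)"

section \<open>The boundary term: derivative, continuity, vanishing at both ends\<close>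

lemma gig_int_has_real_derivative_shift:
  assumes "x \<noteq> \<mu>"
  shows "((\<lambda>x. gig_int \<alpha> s (x - \<mu>)) has_real_derivative - ((x - \<mu>) * gig_int \<alpha> (s - 1) (x - \<mu>))) (at x)"
proof -
  have "(gig_int \<alpha> s has_real_derivative - ((x - \<mu>) * gig_int \<alpha> (s - 1) (x - \<mu>))) (at (x - \<mu>))"
    using assms \<alpha>_pos by (intro gig_int_has_real_derivative) auto
  from DERIV_shift[of "gig_int \<alpha> s" _ x "- \<mu>", THEN iffD1] this show ?thesis by simp
qed

text \<open>Write y = x - \<mu> and G_s for \<open>gig_int \<alpha> s y\<close>. By the recurrence,
  y G_\<nu> has derivative (2 \<nu> + 1) G_\<nu> - \<alpha>^2 G_(\<nu>+1), and G_(\<nu>+1) has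
  derivative - y G_\<nu>. All terms with G_(\<nu>+1) cancel; what remains is G_\<nu> times the Stein
  operator, with \<beta>^2 - \<alpha>^2 supplying the coefficient of y f.\<close>

lemma stein_primitive_has_derivative:
  assumes x: "x \<noteq> \<mu>"
    and f: "(f has_real_derivative deriv f x) (at x)"
    and f': "(deriv f has_real_derivative deriv (deriv f) x) (at x)"
  shows "(stein_primitive f has_real_derivative p x * stein_VG2 \<nu> \<alpha> \<beta> \<mu> f x) (at x)"
proof -
  define y where "y = x - \<mu>"
  define G where "G = gig_int \<alpha> \<nu> y"
  define G1 where "G1 = gig_int \<alpha> (\<nu> + 1) y"
  define G0 where "G0 = gig_int \<alpha> (\<nu> - 1) y"
  have y: "y \<noteq> 0" using x by (simp add: y_def)
  have rec: "y * (y * G0) = \<alpha>\<^sup>2 * G1 - 2 * \<nu> * G"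
    using gig_int_recurrence[OF \<alpha>_pos y, of \<nu>] by (simp add: G_def G1_def G0_def power2_eq_square)
  have dE: "((\<lambda>x. C * exp (\<beta> * (x - \<mu>))) has_real_derivative \<beta> * (C * exp (\<beta> * y))) (at x)"
    by (auto intro!: derivative_eq_intros simp: y_def)
  have dG: "((\<lambda>x. (x - \<mu>) * gig_int \<alpha> \<nu> (x - \<mu>)) has_real_derivative (1 + 2 * \<nu>) * G - \<alpha>\<^sup>2 * G1) (at x)"
  proof -
    have "((\<lambda>x. (x - \<mu>) * gig_int \<alpha> \<nu> (x - \<mu>)) has_real_derivative G - y * (y * G0)) (at x)"
      using x gig_int_has_real_derivative_shift[OF x, of \<nu>]
      by (auto intro!: derivative_eq_intros simp: y_def G_def G0_def)
    then show ?thesis unfolding rec by (simp add: algebra_simps)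
  qed
  have dG1: "((\<lambda>x. gig_int \<alpha> (\<nu> + 1) (x - \<mu>)) has_real_derivative - (y * G)) (at x)"
    using gig_int_has_real_derivative_shift[OF x, of "\<nu> + 1"] by (simp add: y_def G_def)
  have "(stein_primitive f has_real_derivative
      (\<beta> * (C * exp (\<beta> * y))) * ((y * G) * deriv f x + (\<beta> * (y * G) + \<alpha>\<^sup>2 * G1) * f x)
      + ((((1 + 2 * \<nu>) * G - \<alpha>\<^sup>2 * G1) * deriv f x + deriv (deriv f) x * (y * G))
         + ((\<beta> * ((1 + 2 * \<nu>) * G - \<alpha>\<^sup>2 * G1) + \<alpha>\<^sup>2 * (- (y * G))) * f x + deriv f x * (\<beta> * (y * G) + \<alpha>\<^sup>2 * G1)))
        * (C * exp (\<beta> * y))) (at x)"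
    unfolding stein_primitive_def[abs_def] y_def G_def G1_def
    by (rule DERIV_mult dE[unfolded y_def G_def G1_def] DERIV_add dG[unfolded y_def G_def G1_def]
        f f' DERIV_cmult dG1[unfolded y_def G_def G1_def])+
  moreover have "p x = C * exp (\<beta> * y) * G" using VG2_density_eq[OF x] by (simp add: y_def G_def)
  ultimately show ?thesis
    by (elim DERIV_cong) (simp add: stein_VG2_def algebra_simps power2_eq_square flip: y_def)
qed

text \<open>Continuity across \<mu> ensures that this point contributes nothing to the integration
  by parts over the line.\<close>

lemma continuous_on_stein_primitive:
  assumes "continuous_on UNIV f" "continuous_on UNIV (deriv f)"
  shows "continuous_on UNIV (stein_primitive f)"
proof -
  have "isCont (\<lambda>y. y * gig_int \<alpha> \<nu> y) z" for z
  proof (cases "z = 0")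
    case False
    then show ?thesis
      using DERIV_isCont[OF gig_int_has_real_derivative[OF \<alpha>_pos False, of \<nu>]] by (intro continuous_intros)
  qed (use isCont_mult_gig_int_0[OF \<alpha>_pos \<nu>] in simp)
  then have 1: "continuous_on UNIV (\<lambda>x. (x - \<mu>) * gig_int \<alpha> \<nu> (x - \<mu>))"
    by (intro continuous_at_imp_continuous_on ballI isCont_o2[of _ "\<lambda>x. x - \<mu>" "\<lambda>y. y * gig_int \<alpha> \<nu> y"])
       (auto intro!: continuous_intros)
  have "isCont (gig_int \<alpha> (\<nu> + 1)) z" for z
    using \<nu> \<alpha>_pos by (intro isCont_gig_int) auto
  then have 2: "continuous_on UNIV (\<lambda>x. gig_int \<alpha> (\<nu> + 1) (x - \<mu>))"
    by (intro continuous_at_imp_continuous_on ballI isCont_o2[of _ "\<lambda>x. x - \<mu>" "gig_int \<alpha> (\<nu> + 1)"])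
       (auto intro!: continuous_intros)
  show ?thesis
    unfolding stein_primitive_def[abs_def] by (intro continuous_intros 1 2 assms)
qed

text \<open>For |y| \<ge> 1, \<open>gig_int_le\<close> bounds both y G_\<nu> and G_(\<nu>+1) by
  multiples of |y|^(\<nu>+1) exp (- \<alpha> |y|). The constant \<open>K\<close> is the same for all
  f.\<close>

lemma stein_primitive_bound:
  obtains K where "K \<ge> 0"
    "\<And>f x. \<bar>x - \<mu>\<bar> \<ge> 1 \<Longrightarrow> \<bar>stein_primitive f x\<bar> \<le>
       K * (\<bar>x - \<mu>\<bar> powr (\<nu> + 1) * exp (\<beta> * (x - \<mu>) - \<alpha> * \<bar>x - \<mu>\<bar>)) * (\<bar>f x\<bar> + \<bar>deriv f x\<bar>)"
proof -
  define c where "c = exp \<alpha> * gig_int \<alpha> \<nu> 1"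
  define c1 where "c1 = exp \<alpha> * gig_int \<alpha> (\<nu> + 1) 1"
  define K where "K = C * (c + \<bar>\<beta>\<bar> * c + \<alpha>\<^sup>2 * c1)"
  have c: "c \<ge> 0" "c1 \<ge> 0" by (auto simp: c_def c1_def gig_int_nonneg)
  show ?thesis
  proof
    show "K \<ge> 0" using c C_pos by (simp add: K_def)
    fix f x assume x: "\<bar>x - \<mu>\<bar> \<ge> 1"
    define y where "y = x - \<mu>"
    define D where "D = \<bar>y\<bar> powr (\<nu> + 1) * exp (- (\<alpha> * \<bar>y\<bar>))"
    define F where "F = \<bar>f x\<bar> + \<bar>deriv f x\<bar>"
    have y: "\<bar>y\<bar> \<ge> 1" using x by (simp add: y_def)
    have D: "D \<ge> 0" by (simp add: D_def)
    have "\<bar>y * gig_int \<alpha> \<nu> y\<bar> = \<bar>y\<bar> * gig_int \<alpha> \<nu> y" by (simp add: abs_mult gig_int_nonneg)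
    also have "\<dots> \<le> \<bar>y\<bar> * (c * \<bar>y\<bar> powr \<nu> * exp (- (\<alpha> * \<bar>y\<bar>)))"
      using gig_int_le[OF \<alpha>_pos y, of \<nu>] by (intro mult_left_mono) (auto simp: c_def)
    also have "\<dots> = c * D" using y by (simp add: D_def powr_add)
    finally have A: "\<bar>y * gig_int \<alpha> \<nu> y\<bar> \<le> c * D" .
    have B: "\<bar>\<alpha>\<^sup>2 * gig_int \<alpha> (\<nu> + 1) y\<bar> \<le> \<alpha>\<^sup>2 * (c1 * D)"
    proof -
      have "gig_int \<alpha> (\<nu> + 1) y \<le> c1 * D"
        using gig_int_le[OF \<alpha>_pos y, of "\<nu> + 1"] by (simp add: c1_def D_def mult.assoc)
      then show ?thesis by (simp add: abs_mult gig_int_nonneg mult_left_mono)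
    qed
    have "\<bar>stein_primitive f x\<bar> = C * exp (\<beta> * y) *
      \<bar>(y * gig_int \<alpha> \<nu> y) * deriv f x + (\<beta> * (y * gig_int \<alpha> \<nu> y) + \<alpha>\<^sup>2 * gig_int \<alpha> (\<nu> + 1) y) * f x\<bar>"
      using C_pos by (simp add: stein_primitive_def abs_mult flip: y_def)
    also have "\<dots> \<le> C * exp (\<beta> * y) * ((c * D) * F + (\<bar>\<beta>\<bar> * (c * D) + \<alpha>\<^sup>2 * (c1 * D)) * F)"
    proof (intro mult_left_mono order.trans[OF abs_triangle_ineq] add_mono)
      show "\<bar>(y * gig_int \<alpha> \<nu> y) * deriv f x\<bar> \<le> (c * D) * F"
        unfolding abs_mult[of "y * gig_int \<alpha> \<nu> y"] using A by (intro mult_mono) (auto simp: F_def c D)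
      have "\<bar>\<beta> * (y * gig_int \<alpha> \<nu> y)\<bar> \<le> \<bar>\<beta>\<bar> * (c * D)"
        unfolding abs_mult[of \<beta>] using A by (intro mult_left_mono) auto
      with B have "\<bar>\<beta> * (y * gig_int \<alpha> \<nu> y) + \<alpha>\<^sup>2 * gig_int \<alpha> (\<nu> + 1) y\<bar> \<le> \<bar>\<beta>\<bar> * (c * D) + \<alpha>\<^sup>2 * (c1 * D)"
        by linarith
      then show "\<bar>(\<beta> * (y * gig_int \<alpha> \<nu> y) + \<alpha>\<^sup>2 * gig_int \<alpha> (\<nu> + 1) y) * f x\<bar> \<le> (\<bar>\<beta>\<bar> * (c * D) + \<alpha>\<^sup>2 * (c1 * D)) * F"
        unfolding abs_mult[of _ "f x"] by (intro mult_mono) (auto simp: F_def c D)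
    qed (use C_pos in auto)
    also have "\<dots> = K * (exp (\<beta> * y) * D) * F" by (simp add: K_def algebra_simps)
    also have "exp (\<beta> * y) * D = \<bar>y\<bar> powr (\<nu> + 1) * exp (\<beta> * y - \<alpha> * \<bar>y\<bar>)"
      by (simp add: D_def exp_diff exp_minus divide_inverse)
    finally show "\<bar>stein_primitive f x\<bar> \<le>
       K * (\<bar>x - \<mu>\<bar> powr (\<nu> + 1) * exp (\<beta> * (x - \<mu>) - \<alpha> * \<bar>x - \<mu>\<bar>)) * (\<bar>f x\<bar> + \<bar>deriv f x\<bar>)"
      by (simp add: y_def F_def)
  qed
qed

text \<open>The growth conditions weigh f by powers of x or - x, the boundary term by powers of |x -
  \<mu>|. For r \<ge> |\<mu>| the shift at most doubles r, and r \<ge> 1 allows raising the exponent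
  from \<nu> + 1 to \<nu> + 3/2.\<close>

lemma shifted_powr_le:
  fixes r :: real
  assumes "r \<ge> 1" "r \<ge> \<bar>\<mu>\<bar>" "0 \<le> t" "t \<le> r + \<bar>\<mu>\<bar>"
  shows "t powr (\<nu> + 1) \<le> 2 powr (\<nu> + 1) * r powr (\<nu> + 3/2)"
proof -
  have "t powr (\<nu> + 1) \<le> (2 * r) powr (\<nu> + 1)"
    using assms \<nu> by (intro powr_mono2) auto
  also have "\<dots> = 2 powr (\<nu> + 1) * r powr (\<nu> + 1)"
    by (rule powr_mult)
  also have "\<dots> \<le> 2 powr (\<nu> + 1) * r powr (\<nu> + 3/2)"
    using assms by (intro mult_left_mono powr_mono) auto
  finally show ?thesis .
qed

lemma stein_primitive_at_top:
  assumes "((\<lambda>x. f x * x powr (\<nu> + 3/2) * exp (- (\<alpha> - \<beta>) * x)) \<longlongrightarrow> 0) at_top"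
    and "((\<lambda>x. deriv f x * x powr (\<nu> + 3/2) * exp (- (\<alpha> - \<beta>) * x)) \<longlongrightarrow> 0) at_top"
  shows "(stein_primitive f \<longlongrightarrow> 0) at_top"
proof -
  obtain K where K: "K \<ge> 0" "\<And>f x. \<bar>x - \<mu>\<bar> \<ge> 1 \<Longrightarrow> \<bar>stein_primitive f x\<bar> \<le>
       K * (\<bar>x - \<mu>\<bar> powr (\<nu> + 1) * exp (\<beta> * (x - \<mu>) - \<alpha> * \<bar>x - \<mu>\<bar>)) * (\<bar>f x\<bar> + \<bar>deriv f x\<bar>)"
    using stein_primitive_bound by blast
  \<comment> \<open>The factor exp ((\<alpha> - \<beta>) \<mu>) moves the centre of the exponential
    weight from \<mu> to 0.\<close>
  define L where "L = K * (2 powr (\<nu> + 1) * exp ((\<alpha> - \<beta>) * \<mu>))"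
  define g where "g = (\<lambda>x. L * (\<bar>f x * x powr (\<nu> + 3/2) * exp (- (\<alpha> - \<beta>) * x)\<bar> + \<bar>deriv f x * x powr (\<nu> + 3/2) * exp (- (\<alpha> - \<beta>) * x)\<bar>))"
  show ?thesis
  proof (rule Lim_null_comparison)
    show "\<forall>\<^sub>F x in at_top. norm (stein_primitive f x) \<le> g x"
      using eventually_ge_at_top[of "1 + \<bar>\<mu>\<bar>"]
    proof eventually_elim
      fix x :: real assume x: "1 + \<bar>\<mu>\<bar> \<le> x"
      then have x': "x - \<mu> \<ge> 1" by linarith
      have "\<bar>stein_primitive f x\<bar> \<le> K * ((x - \<mu>) powr (\<nu> + 1) * exp (\<beta> * (x - \<mu>) - \<alpha> * (x - \<mu>))) * (\<bar>f x\<bar> + \<bar>deriv f x\<bar>)"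
        using K(2)[of x f] x' by simp
      also have "\<dots> \<le> K * ((2 powr (\<nu> + 1) * x powr (\<nu> + 3/2)) * exp (\<beta> * (x - \<mu>) - \<alpha> * (x - \<mu>))) * (\<bar>f x\<bar> + \<bar>deriv f x\<bar>)"
        using x K(1) by (intro mult_right_mono mult_left_mono shifted_powr_le) auto
      also have "exp (\<beta> * (x - \<mu>) - \<alpha> * (x - \<mu>)) = exp ((\<alpha> - \<beta>) * \<mu>) * exp (- (\<alpha> - \<beta>) * x)"
        by (simp add: algebra_simps flip: exp_add)
      also have "K * ((2 powr (\<nu> + 1) * x powr (\<nu> + 3/2)) * (exp ((\<alpha> - \<beta>) * \<mu>) * exp (- (\<alpha> - \<beta>) * x))) * (\<bar>f x\<bar> + \<bar>deriv f x\<bar>) = g x"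
        by (simp add: g_def L_def abs_mult algebra_simps)
      finally show "norm (stein_primitive f x) \<le> g x" by simp
    qed
    have "(g \<longlongrightarrow> L * (\<bar>0\<bar> + \<bar>0\<bar>)) at_top" unfolding g_def by (intro tendsto_intros assms)
    then show "(g \<longlongrightarrow> 0) at_top" by simp
  qed
qed

lemma stein_primitive_at_bot:
  assumes "((\<lambda>x. f x * (- x) powr (\<nu> + 3/2) * exp ((\<alpha> + \<beta>) * x)) \<longlongrightarrow> 0) at_bot"
    and "((\<lambda>x. deriv f x * (- x) powr (\<nu> + 3/2) * exp ((\<alpha> + \<beta>) * x)) \<longlongrightarrow> 0) at_bot"
  shows "(stein_primitive f \<longlongrightarrow> 0) at_bot"
proof -
  obtain K where K: "K \<ge> 0" "\<And>f x. \<bar>x - \<mu>\<bar> \<ge> 1 \<Longrightarrow> \<bar>stein_primitive f x\<bar> \<le>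
       K * (\<bar>x - \<mu>\<bar> powr (\<nu> + 1) * exp (\<beta> * (x - \<mu>) - \<alpha> * \<bar>x - \<mu>\<bar>)) * (\<bar>f x\<bar> + \<bar>deriv f x\<bar>)"
    using stein_primitive_bound by blast
  \<comment> \<open>On this side |x - \<mu>| = \<mu> - x, so the exponent is (\<alpha> + \<beta>) (x
    - \<mu>).\<close>
  define L where "L = K * (2 powr (\<nu> + 1) * exp (- ((\<alpha> + \<beta>) * \<mu>)))"
  define g where "g = (\<lambda>x. L * (\<bar>f x * (- x) powr (\<nu> + 3/2) * exp ((\<alpha> + \<beta>) * x)\<bar> + \<bar>deriv f x * (- x) powr (\<nu> + 3/2) * exp ((\<alpha> + \<beta>) * x)\<bar>))"
  show ?thesis
  proof (rule Lim_null_comparison)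
    show "\<forall>\<^sub>F x in at_bot. norm (stein_primitive f x) \<le> g x"
      using eventually_le_at_bot[of "- (1 + \<bar>\<mu>\<bar>)"]
    proof eventually_elim
      fix x :: real assume x: "x \<le> - (1 + \<bar>\<mu>\<bar>)"
      then have x': "\<mu> - x \<ge> 1" "\<bar>x - \<mu>\<bar> = \<mu> - x" by linarith+
      have "\<bar>stein_primitive f x\<bar> \<le> K * ((\<mu> - x) powr (\<nu> + 1) * exp (\<beta> * (x - \<mu>) - \<alpha> * (\<mu> - x))) * (\<bar>f x\<bar> + \<bar>deriv f x\<bar>)"
        using K(2)[of x f] x' by simp
      also have "\<dots> \<le> K * ((2 powr (\<nu> + 1) * (- x) powr (\<nu> + 3/2)) * exp (\<beta> * (x - \<mu>) - \<alpha> * (\<mu> - x))) * (\<bar>f x\<bar> + \<bar>deriv f x\<bar>)"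
        using x K(1) by (intro mult_right_mono mult_left_mono shifted_powr_le) auto
      also have "exp (\<beta> * (x - \<mu>) - \<alpha> * (\<mu> - x)) = exp (- ((\<alpha> + \<beta>) * \<mu>)) * exp ((\<alpha> + \<beta>) * x)"
        by (simp add: algebra_simps flip: exp_add)
      also have "K * ((2 powr (\<nu> + 1) * (- x) powr (\<nu> + 3/2)) * (exp (- ((\<alpha> + \<beta>) * \<mu>)) * exp ((\<alpha> + \<beta>) * x))) * (\<bar>f x\<bar> + \<bar>deriv f x\<bar>) = g x"
        by (simp add: g_def L_def abs_mult algebra_simps)
      finally show "norm (stein_primitive f x) \<le> g x" by simp
    qed
    have "(g \<longlongrightarrow> L * (\<bar>0\<bar> + \<bar>0\<bar>)) at_bot" unfolding g_def by (intro tendsto_intros assms)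
    then show "(g \<longlongrightarrow> 0) at_bot" by simp
  qed
qed

end

text \<open>The fundamental theorem of calculus on [- n, n], then dominated convergence as n grows.
  Continuity of \<open>H\<close> permits finitely many points without derivative.\<close>

lemma integral_eq_0_if_primitive_vanishes:
  fixes h H :: "real \<Rightarrow> real"
  assumes h: "integrable lborel h" and H: "continuous_on UNIV H" and S: "finite S"
    and deriv: "\<And>x. x \<notin> S \<Longrightarrow> (H has_real_derivative h x) (at x)"
    and lim: "(H \<longlongrightarrow> 0) at_top" "(H \<longlongrightarrow> 0) at_bot"
  shows "(\<integral>x. h x \<partial>lborel) = 0"
proof -
  have "(\<lambda>n. \<integral>x. indicator {- real n..real n} x * h x \<partial>lborel) \<longlonglongrightarrow> (\<integral>x. h x \<partial>lborel)"
  proof (rule integral_dominated_convergence[where w = "\<lambda>x. norm (h x)"])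
    show "AE x in lborel. (\<lambda>n. indicator {- real n..real n} x * h x) \<longlonglongrightarrow> h x"
    proof (intro AE_I2 tendsto_eventually)
      fix x :: real
      show "\<forall>\<^sub>F n in sequentially. indicator {- real n..real n} x * h x = h x"
        using eventually_ge_at_top[of "nat \<lceil>\<bar>x\<bar>\<rceil>"]
      proof eventually_elim
        fix n assume "nat \<lceil>\<bar>x\<bar>\<rceil> \<le> n"
        then have "\<bar>x\<bar> \<le> real n" by linarith
        then show "indicator {- real n..real n} x * h x = h x" by (auto simp: indicator_def)
      qed
    qed
  qed (use h in \<open>auto simp: indicator_def\<close>)
  moreover have "(\<integral>x. indicator {- real n..real n} x * h x \<partial>lborel) = H (real n) - H (- real n)" for n
  proof -
    have "(h has_integral H (real n) - H (- real n)) {- real n..real n}"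
      using deriv H by (intro fundamental_theorem_of_calculus_interior_strong[OF S])
        (auto simp: has_real_derivative_iff_has_vector_derivative intro: continuous_on_subset)
    moreover have "set_integrable lborel {- real n..real n} h"
      using h by (simp add: set_integrable_def integrable_mult_indicator[where 'b=real, simplified])
    ultimately show ?thesis
      using set_borel_integral_eq_integral(2)[of "{- real n..real n}" h]
      by (simp add: integral_unique set_lebesgue_integral_def)
  qed
  moreover have "(\<lambda>n. H (real n) - H (- real n)) \<longlonglongrightarrow> 0 - 0"
    by (intro tendsto_diff filterlim_compose[OF lim(1) filterlim_real_sequentially]
        filterlim_compose[OF lim(2)] filterlim_compose[OF filterlim_uminus_at_bot_at_top filterlim_real_sequentially])
  ultimately show ?thesis by (metis (no_types, lifting) LIMSEQ_unique diff_zero ext)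
qed

lemma piecewise_C2_derivs:
  assumes "piecewise_C2 f"
  obtains S where "finite S" "\<And>x. (f has_real_derivative deriv f x) (at x)" "continuous_on UNIV (deriv f)"
    "\<And>x. x \<notin> S \<Longrightarrow> (deriv f has_real_derivative deriv (deriv f) x) (at x)"
    "continuous_on (- S) (deriv (deriv f))"
proof -
  have f: "(f has_real_derivative deriv f x) (at x)" for x
    using assms by (simp add: piecewise_C2_def DERIV_deriv_iff_real_differentiable)
  obtain S D where S: "continuous_on UNIV (deriv f)" "finite S"
    and D: "\<And>x. x \<in> UNIV - S \<Longrightarrow> (deriv f has_vector_derivative D x) (at x)" "continuous_on (UNIV - S) D"
    using assms unfolding piecewise_C2_def piecewise_C1_differentiable_on_def C1_differentiable_on_def by blast
  have D': "(deriv f has_real_derivative D x) (at x)" if "x \<notin> S" for x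
    using D(1)[of x] that by (simp add: has_real_derivative_iff_has_vector_derivative)
  then have eq: "deriv (deriv f) x = D x" if "x \<notin> S" for x
    using that by (intro DERIV_imp_deriv) auto
  have "continuous_on (- S) (deriv (deriv f))"
    using D(2) by (subst continuous_on_cong[OF refl eq]) (auto simp: Compl_eq_Diff_UNIV)
  then show ?thesis
    using that[of S] f S D' eq by auto
qed

lemma stein_VG2_measurable:
  assumes "piecewise_C2 f"
  shows "stein_VG2 \<nu> \<alpha> \<beta> \<mu> f \<in> borel_measurable borel"
proof -
  obtain S where S: "finite S" "\<And>x. (f has_real_derivative deriv f x) (at x)" "continuous_on UNIV (deriv f)"
    "continuous_on (- S) (deriv (deriv f))"
    using piecewise_C2_derivs[OF assms] by metis
  have [measurable]: "f \<in> borel_measurable borel" "deriv f \<in> borel_measurable borel"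
    using S by (auto intro!: borel_measurable_continuous_onI continuous_at_imp_continuous_on DERIV_isCont)
  have "(\<lambda>x. indicator (- S) x *\<^sub>R deriv (deriv f) x) \<in> borel_measurable borel"
    using S by (intro borel_measurable_continuous_on_indicator) (auto intro: borel_open open_Compl finite_imp_closed)
  \<comment> \<open>On the finite set \<open>S\<close> the second derivative is an unspecified
    number; changing a function at countably many points preserves measurability.\<close>
  then have [measurable]: "deriv (deriv f) \<in> borel_measurable borel"
    by (rule measurable_discrete_difference[where X = S]) (use S(1) in \<open>auto simp: countable_finite\<close>)
  show ?thesis unfolding stein_VG2_def[abs_def] by measurable
qed

context VG2_params
begin

lemma VG2_stein_identity:
  assumes W: "distributed M lborel W (\<lambda>x. ennreal (p x))"
    and f: "piecewise_C2 f"
    and top: "\<And>k. k \<le> 1 \<Longrightarrow> ((\<lambda>x. (deriv ^^ k) f x * x powr (\<nu> + 3/2) * exp (- (\<alpha> - \<beta>) * x)) \<longlongrightarrow> 0) at_top"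
    and bot: "\<And>k. k \<le> 1 \<Longrightarrow> ((\<lambda>x. (deriv ^^ k) f x * (- x) powr (\<nu> + 3/2) * exp ((\<alpha> + \<beta>) * x)) \<longlongrightarrow> 0) at_bot"
    and int: "integrable M (\<lambda>\<omega>. stein_VG2 \<nu> \<alpha> \<beta> \<mu> f (W \<omega>))"
  shows "(\<integral>\<omega>. stein_VG2 \<nu> \<alpha> \<beta> \<mu> f (W \<omega>) \<partial>M) = 0"
proof -
  have meas: "stein_VG2 \<nu> \<alpha> \<beta> \<mu> f \<in> borel_measurable lborel"
    using stein_VG2_measurable[OF f] by simp
  obtain S where S: "finite S" "\<And>x. (f has_real_derivative deriv f x) (at x)" "continuous_on UNIV (deriv f)"
    "\<And>x. x \<notin> S \<Longrightarrow> (deriv f has_real_derivative deriv (deriv f) x) (at x)"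
    using piecewise_C2_derivs[OF f] by metis
  \<comment> \<open>The point \<mu> joins the exceptional set, since the kernel integrals are
    differentiated only off the origin.\<close>
  have "(\<integral>x. p x * stein_VG2 \<nu> \<alpha> \<beta> \<mu> f x \<partial>lborel) = 0"
  proof (rule integral_eq_0_if_primitive_vanishes[where H = "stein_primitive f" and S = "insert \<mu> S"])
    show "integrable lborel (\<lambda>x. p x * stein_VG2 \<nu> \<alpha> \<beta> \<mu> f x)"
      using distributed_integrable[OF W meas] int VG2_density_nonneg by simp
    show "continuous_on UNIV (stein_primitive f)"
      using S by (intro continuous_on_stein_primitive) (auto intro!: continuous_at_imp_continuous_on DERIV_isCont)
    show "(stein_primitive f \<longlongrightarrow> 0) at_top"
      using top[of 0] top[of 1] by (intro stein_primitive_at_top) auto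
    show "(stein_primitive f \<longlongrightarrow> 0) at_bot"
      using bot[of 0] bot[of 1] by (intro stein_primitive_at_bot) auto
  qed (use S in \<open>auto intro!: stein_primitive_has_derivative\<close>)
  then show ?thesis
    using distributed_integral[OF W meas] VG2_density_nonneg by simp
qed

end

section \<open>Characterisation\<close>

context VG2_params
begin

section \<open>The Stein condition and its bounded test functions\<close>

definition stein_char :: "'a measure \<Rightarrow> ('a \<Rightarrow> real) \<Rightarrow> bool" where
  "stein_char M W \<longleftrightarrow>
    (\<forall>f :: real \<Rightarrow> real.
       piecewise_C2 f \<longrightarrow>
       (\<forall>k\<le>2.
          ((\<lambda>x. (deriv ^^ k) f x * x powr (\<nu> + 3/2) * exp (- (\<alpha> - \<beta>) * x)) \<longlongrightarrow> 0) at_top \<and>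
          ((\<lambda>x. (deriv ^^ k) f x * (- x) powr (\<nu> + 3/2) * exp ((\<alpha> + \<beta>) * x)) \<longlongrightarrow> 0) at_bot) \<longrightarrow>
       integrable M (\<lambda>\<omega>. stein_VG2 \<nu> \<alpha> \<beta> \<mu> f (W \<omega>)) \<longrightarrow>
       (\<integral>\<omega>. stein_VG2 \<nu> \<alpha> \<beta> \<mu> f (W \<omega>) \<partial>M) = 0)"

lemma distributed_imp_stein_char:
  assumes "distributed M lborel W (\<lambda>x. ennreal (p x))"
  shows "stein_char M W"
  unfolding stein_char_def
proof (intro allI impI)
  fix f :: "real \<Rightarrow> real"
  assume f: "piecewise_C2 f" "integrable M (\<lambda>\<omega>. stein_VG2 \<nu> \<alpha> \<beta> \<mu> f (W \<omega>))"
    and lim: "\<forall>k\<le>2.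
          ((\<lambda>x. (deriv ^^ k) f x * x powr (\<nu> + 3/2) * exp (- (\<alpha> - \<beta>) * x)) \<longlongrightarrow> 0) at_top \<and>
          ((\<lambda>x. (deriv ^^ k) f x * (- x) powr (\<nu> + 3/2) * exp ((\<alpha> + \<beta>) * x)) \<longlongrightarrow> 0) at_bot"
  then have lim': "((\<lambda>x. (deriv ^^ k) f x * x powr (\<nu> + 3/2) * exp (- (\<alpha> - \<beta>) * x)) \<longlongrightarrow> 0) at_top"
    "((\<lambda>x. (deriv ^^ k) f x * (- x) powr (\<nu> + 3/2) * exp ((\<alpha> + \<beta>) * x)) \<longlongrightarrow> 0) at_bot" if "k \<le> 1" for k
    using le_trans[OF that one_le_numeral] by auto
  show "(\<integral>\<omega>. stein_VG2 \<nu> \<alpha> \<beta> \<mu> f (W \<omega>) \<partial>M) = 0"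
    by (rule VG2_stein_identity[OF assms f(1) lim' f(2)])
qed

text \<open>Both rates \<alpha> - \<beta> and \<alpha> + \<beta> are positive because \<alpha> >
  |\<beta>|, so the exponential beats the power; the left end follows by reflection.\<close>

lemma bounded_growth:
  assumes "\<And>x::real. \<bar>g x\<bar> \<le> B"
  shows "((\<lambda>x. g x * x powr (\<nu> + 3/2) * exp (- (\<alpha> - \<beta>) * x)) \<longlongrightarrow> 0) at_top"
    "((\<lambda>x. g x * (- x) powr (\<nu> + 3/2) * exp ((\<alpha> + \<beta>) * x)) \<longlongrightarrow> 0) at_bot"
proof -
  have top: "((\<lambda>x::real. x powr r * exp (- a * x)) \<longlongrightarrow> 0) at_top" if "a > 0" for r a
    using that by real_asymp
  have 0: "((\<lambda>x. h x * (x powr r * exp (- a * x))) \<longlongrightarrow> 0) at_top" if "a > 0" "\<And>x. \<bar>h x\<bar> \<le> B" for r a h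
  proof (rule Lim_null_comparison)
    show "((\<lambda>x. B * (x powr r * exp (- a * x))) \<longlongrightarrow> 0) at_top"
      using tendsto_mult_left[OF top[OF that(1), of r], of B] by simp
    show "\<forall>\<^sub>F x in at_top. norm (h x * (x powr r * exp (- a * x))) \<le> B * (x powr r * exp (- a * x))"
      using that(2) by (intro always_eventually allI) (simp add: abs_mult mult_right_mono)
  qed
  show "((\<lambda>x. g x * x powr (\<nu> + 3/2) * exp (- (\<alpha> - \<beta>) * x)) \<longlongrightarrow> 0) at_top"
    using 0[of "\<alpha> - \<beta>" g "\<nu> + 3/2"] assms \<alpha>\<beta> by (simp add: mult.assoc)
  show "((\<lambda>x. g x * (- x) powr (\<nu> + 3/2) * exp ((\<alpha> + \<beta>) * x)) \<longlongrightarrow> 0) at_bot"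
  proof -
    have "((\<lambda>x. g (- x) * (x powr (\<nu> + 3/2) * exp (- (\<alpha> + \<beta>) * x))) \<longlongrightarrow> 0) at_top"
      by (rule 0) (use assms \<alpha>\<beta> in auto)
    moreover have "(\<alpha> + \<beta>) * - x = - (\<alpha> + \<beta>) * x" for x by (simp add: algebra_simps)
    ultimately show ?thesis unfolding filterlim_at_bot_mirror by (simp only: minus_minus mult.assoc)
  qed
qed

text \<open>This is how the converse uses the Stein condition: for a function with bounded
  derivatives up to order two the growth conditions are automatic, and only integrability is left to
  the caller. The function is twice continuously differentiable everywhere, so the exceptional set
  is empty and \<open>deriv (deriv f)\<close> is the genuine second derivative.\<close>

lemma stein_char_bounded:
  assumes stein: "stein_char M W"
    and f: "\<And>x. (f has_real_derivative f1 x) (at x)" "\<And>x. (f1 has_real_derivative f2 x) (at x)"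
    and cont: "continuous_on UNIV f2"
    and bdd: "\<And>x. \<bar>f x\<bar> \<le> B" "\<And>x. \<bar>f1 x\<bar> \<le> B" "\<And>x. \<bar>f2 x\<bar> \<le> B"
    and F: "\<And>x. F x = (x - \<mu>) * f2 x + (2 * \<nu> + 1 + 2 * \<beta> * (x - \<mu>)) * f1 x + ((2 * \<nu> + 1) * \<beta> - \<gamma> * (x - \<mu>)) * f x"
    and int: "integrable M (\<lambda>\<omega>. F (W \<omega>))"
  shows "(\<integral>\<omega>. F (W \<omega>) \<partial>M) = 0"
proof -
  have d1: "deriv f = f1" and d2: "deriv f1 = f2"
    using f by (auto intro!: ext DERIV_imp_deriv)
  have dk: "(deriv ^^ k) f = f \<or> (deriv ^^ k) f = f1 \<or> (deriv ^^ k) f = f2" if "k \<le> 2" for k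
  proof -
    have "k = 0 \<or> k = 1 \<or> k = Suc (Suc 0)" using that by auto
    then show ?thesis by (auto simp: d1 d2)
  qed
  have "piecewise_C2 f"
    unfolding piecewise_C2_def piecewise_C1_differentiable_on_def C1_differentiable_on_def d1
  proof (intro conjI allI exI[of _ "{}"] exI[of _ f2])
    show "f differentiable at x" for x using f(1) by (auto simp: real_differentiable_def)
    show "continuous_on UNIV f1"
      using f(2) by (auto intro!: continuous_at_imp_continuous_on DERIV_isCont)
  qed (use f(2) cont in \<open>auto simp: has_real_derivative_iff_has_vector_derivative\<close>)
  moreover have "\<bar>(deriv ^^ k) f x\<bar> \<le> B" if "k \<le> 2" for k x
    using dk[OF that] bdd by auto
  then have "\<forall>k\<le>2.
      ((\<lambda>x. (deriv ^^ k) f x * x powr (\<nu> + 3/2) * exp (- (\<alpha> - \<beta>) * x)) \<longlongrightarrow> 0) at_top \<and>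
      ((\<lambda>x. (deriv ^^ k) f x * (- x) powr (\<nu> + 3/2) * exp ((\<alpha> + \<beta>) * x)) \<longlongrightarrow> 0) at_bot"
    by (intro allI impI conjI bounded_growth[where B = B])
  moreover have eq: "stein_VG2 \<nu> \<alpha> \<beta> \<mu> f = F"
    unfolding fun_eq_iff stein_VG2_def d1 d2 F \<gamma>_def by simp
  ultimately have "integrable M (\<lambda>\<omega>. stein_VG2 \<nu> \<alpha> \<beta> \<mu> f (W \<omega>)) \<longrightarrow> (\<integral>\<omega>. stein_VG2 \<nu> \<alpha> \<beta> \<mu> f (W \<omega>) \<partial>M) = 0"
    using stein unfolding stein_char_def by blast
  then show ?thesis using int unfolding eq by blast
qed

text \<open>The test functions \<open>y / (1 + \<epsilon> y\<^sup>2)\<close>, with \<open>y = x - \<mu>\<close>, have a bounded image under the Stein operator,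
  which tends to a quadratic with leading term \<open>- \<gamma> y\<^sup>2\<close> as \<open>\<epsilon> \<rightarrow> 0\<close>.\<close>

lemma stein_char_truncated_moment:
  assumes M: "prob_space M" and W: "W \<in> borel_measurable M" and stein: "stein_char M W"
    and \<epsilon>: "0 < \<epsilon>" "\<epsilon> \<le> 1"
  defines "q \<equiv> \<lambda>\<omega>. (W \<omega> - \<mu>)\<^sup>2 / (1 + \<epsilon> * (W \<omega> - \<mu>)\<^sup>2)"
    and "b \<equiv> 2 * \<bar>\<beta>\<bar> + (2 * \<nu> + 1) * \<bar>\<beta>\<bar>"
  shows "integrable M q" "(\<integral>\<omega>. q \<omega> \<partial>M) \<le> 2 * (2 * \<nu> + 7 + b\<^sup>2 / (2 * \<gamma>)) / \<gamma>"
proof -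
  interpret prob_space M by (rule M)
  note [measurable] = W
  define N where "N = (\<lambda>y::real. 1 + \<epsilon> * y\<^sup>2)"
  define f where "f = (\<lambda>x. (x - \<mu>) / N (x - \<mu>))"
  define f1 where "f1 = (\<lambda>x. (1 - \<epsilon> * (x - \<mu>)\<^sup>2) / (N (x - \<mu>))\<^sup>2)"
  define f2 where "f2 = (\<lambda>x. 2 * \<epsilon> * (x - \<mu>) * (\<epsilon> * (x - \<mu>)\<^sup>2 - 3) / (N (x - \<mu>)) ^ 3)"
  define F where "F = (\<lambda>x. (x - \<mu>) * f2 x + (2 * \<nu> + 1 + 2 * \<beta> * (x - \<mu>)) * f1 x + ((2 * \<nu> + 1) * \<beta> - \<gamma> * (x - \<mu>)) * f x)"
  \<comment> \<open>Here 7 = 6 + 1: the 6 bounds y f'', the 2 \<nu> + 1 bounds (2 \<nu> + 1) f', and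
    b^2 / (2 \<gamma>) is what remains after the terms with \<beta> are absorbed into (\<gamma> / 2)
    q.\<close>
  define K where "K = 2 * \<nu> + 7 + b\<^sup>2 / (2 * \<gamma>)"
  have N: "N y \<ge> 1" "N y > 0" "N y \<noteq> 0" for y
  proof -
    show "N y \<ge> 1" using \<epsilon> by (simp add: N_def)
    then show "N y > 0" "N y \<noteq> 0" by linarith+
  qed
  have f_abs: "\<bar>f x\<bar> = \<bar>x - \<mu>\<bar> / N (x - \<mu>)" for x
    using N(2)[of "x - \<mu>"] by (simp add: f_def)
  have d1: "(f has_real_derivative f1 x) (at x)" for x
  proof -
    define y where "y = x - \<mu>"
    have "(f has_real_derivative (N y - y * (2 * \<epsilon> * y)) / (N y * N y)) (at x)"
      unfolding f_def y_def N_def using N(3)[unfolded N_def]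
      by (auto intro!: derivative_eq_intros simp: mult_ac)
    moreover have "N y - y * (2 * \<epsilon> * y) = 1 - \<epsilon> * y\<^sup>2"
      by (simp add: N_def power2_eq_square)
    ultimately show ?thesis by (simp add: f1_def power2_eq_square[of "N y"] flip: y_def)
  qed
  have d2: "(f1 has_real_derivative f2 x) (at x)" for x
  proof -
    define y where "y = x - \<mu>"
    have "(f1 has_real_derivative (- (2 * \<epsilon> * y) * (N y)\<^sup>2 - (1 - \<epsilon> * y\<^sup>2) * (2 * N y * (2 * \<epsilon> * y))) / ((N y)\<^sup>2 * (N y)\<^sup>2)) (at x)"
      unfolding f1_def y_def N_def using N(3)[unfolded N_def]
      by (auto intro!: derivative_eq_intros simp: mult_ac)
    moreover have "(- (2 * \<epsilon> * y) * (N y)\<^sup>2 - (1 - \<epsilon> * y\<^sup>2) * (2 * N y * (2 * \<epsilon> * y))) / ((N y)\<^sup>2 * (N y)\<^sup>2) = f2 x"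
    proof -
      have "- (2 * \<epsilon> * y) * (N y)\<^sup>2 - (1 - \<epsilon> * y\<^sup>2) * (2 * N y * (2 * \<epsilon> * y)) = N y * (2 * \<epsilon> * y * (\<epsilon> * y\<^sup>2 - 3))"
        by (simp add: N_def algebra_simps power2_eq_square)
      then show ?thesis
        using N(3)[of y] by (simp add: f2_def power2_eq_square power3_eq_cube flip: y_def)
    qed
    ultimately show ?thesis by simp
  qed
  have f1_le: "\<bar>f1 x\<bar> \<le> 1 / N (x - \<mu>)" for x
  proof -
    have "\<bar>1 - \<epsilon> * (x - \<mu>)\<^sup>2\<bar> \<le> N (x - \<mu>)" using \<epsilon> by (simp add: N_def abs_le_iff)
    then show ?thesis
      using N(2)[of "x - \<mu>"] by (simp add: f1_def abs_div_pos[symmetric] power2_eq_square field_simps)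
  qed
  have f_le: "\<bar>f x\<bar> \<le> 1 / \<epsilon>" for x
  proof -
    define y where "y = x - \<mu>"
    have "0 \<le> (\<bar>y\<bar> - 1)\<^sup>2" by simp
    then have "2 * \<bar>y\<bar> \<le> 1 + y\<^sup>2" by (simp add: power2_eq_square algebra_simps)
    then have "\<bar>y\<bar> \<le> 1 + y\<^sup>2" by linarith
    then have "\<epsilon> * \<bar>y\<bar> \<le> \<epsilon> + \<epsilon> * y\<^sup>2" using \<epsilon> mult_left_mono[of "\<bar>y\<bar>" "1 + y\<^sup>2" \<epsilon>] by (simp add: algebra_simps)
    also have "\<dots> \<le> N y" using \<epsilon> by (simp add: N_def)
    finally show ?thesis using N(2)[of y] \<epsilon> by (simp add: f_def field_simps flip: y_def)
  qed
  have f2_le: "\<bar>f2 x\<bar> \<le> 6 * \<epsilon> * \<bar>f x\<bar>" and yf2_le: "\<bar>(x - \<mu>) * f2 x\<bar> \<le> 6" for x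
  proof -
    define y where "y = x - \<mu>"
    have "\<bar>\<epsilon> * y\<^sup>2 - 3\<bar> \<le> 3 * N y" using \<epsilon> by (simp add: N_def abs_le_iff)
    also have "\<dots> \<le> 3 * N y * N y" using N(1)[of y] by simp
    finally have 3: "\<bar>\<epsilon> * y\<^sup>2 - 3\<bar> / (N y)\<^sup>2 \<le> 3" using N(2)[of y] by (simp add: field_simps power2_eq_square)
    have "\<bar>f2 x\<bar> = 2 * \<epsilon> * \<bar>f x\<bar> * (\<bar>\<epsilon> * y\<^sup>2 - 3\<bar> / (N y)\<^sup>2)"
      using \<epsilon> N(2)[of y] by (simp add: f2_def f_def abs_mult power3_eq_cube power2_eq_square flip: y_def)
    also have "\<dots> \<le> 2 * \<epsilon> * \<bar>f x\<bar> * 3" using 3 \<epsilon> by (intro mult_left_mono) auto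
    finally show *: "\<bar>f2 x\<bar> \<le> 6 * \<epsilon> * \<bar>f x\<bar>" by simp
    have "\<epsilon> * (\<bar>y\<bar> * \<bar>f x\<bar>) \<le> 1"
    proof -
      have "\<epsilon> * (\<bar>y\<bar> * \<bar>f x\<bar>) = \<epsilon> * y\<^sup>2 / N y" by (simp add: f_abs power2_eq_square flip: y_def)
      also have "\<dots> \<le> 1" using N(2)[of y] by (simp add: N_def)
      finally show ?thesis .
    qed
    then have "\<bar>y\<bar> * (6 * \<epsilon> * \<bar>f x\<bar>) \<le> 6" by (simp add: mult_ac)
    then show "\<bar>(x - \<mu>) * f2 x\<bar> \<le> 6"
      using mult_left_mono[OF *, of "\<bar>y\<bar>"] by (simp add: abs_mult flip: y_def)
  qed
  have q_eq: "q \<omega> = (W \<omega> - \<mu>) * f (W \<omega>)" for \<omega>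
    by (simp add: q_def f_def N_def power2_eq_square)
  have q_nonneg: "0 \<le> q \<omega>" for \<omega> using \<epsilon> by (simp add: q_def)
  have q_le: "q \<omega> \<le> 1 / \<epsilon>" for \<omega>
    using \<epsilon> N(2)[of "W \<omega> - \<mu>"] by (simp add: q_def N_def field_simps)
  have [measurable]: "q \<in> borel_measurable M" unfolding q_def by measurable
  show q_int: "integrable M q"
    by (rule integrable_const_bound[where B = "1 / \<epsilon>"]) (use q_le q_nonneg in auto)
  \<comment> \<open>Young's inequality, from the square of \<gamma> |y| - b. It spends only half of
    the leading term \<gamma> q, and the other half survives as the quantity to be bounded.\<close>
  have b_f_le: "b * \<bar>f (W \<omega>)\<bar> \<le> \<gamma> / 2 * q \<omega> + b\<^sup>2 / (2 * \<gamma>)" for \<omega>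
  proof -
    define y where "y = W \<omega> - \<mu>"
    have "0 \<le> (\<gamma> * \<bar>y\<bar> - b)\<^sup>2 / (2 * \<gamma>)" using \<gamma>_pos by simp
    also have "\<dots> = \<gamma> / 2 * y\<^sup>2 + b\<^sup>2 / (2 * \<gamma>) - b * \<bar>y\<bar>"
      using \<gamma>_pos by (simp add: power2_eq_square field_simps)
    finally have "b * \<bar>y\<bar> \<le> \<gamma> / 2 * y\<^sup>2 + b\<^sup>2 / (2 * \<gamma>)" by simp
    then have "b * \<bar>y\<bar> / N y \<le> (\<gamma> / 2 * y\<^sup>2 + b\<^sup>2 / (2 * \<gamma>)) / N y"
      using N(2)[of y] by (intro divide_right_mono) auto
    also have "\<dots> = \<gamma> / 2 * q \<omega> + b\<^sup>2 / (2 * \<gamma>) / N y"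
      by (simp add: q_def N_def add_divide_distrib flip: y_def)
    also have "b\<^sup>2 / (2 * \<gamma>) / N y \<le> b\<^sup>2 / (2 * \<gamma>)"
      using N(1)[of y] N(2)[of y] \<gamma>_pos mult_left_mono[of 1 "N y" "b\<^sup>2"] by (simp add: field_simps)
    finally show ?thesis by (simp add: f_abs flip: y_def)
  qed
  \<comment> \<open>The summand - \<gamma> y f of the operator is exactly - \<gamma> q. Among the
    others, 2 \<beta> y f' and (2 \<nu> + 1) \<beta> f together are at most b |f|.\<close>
  have F_bound: "\<bar>F (W \<omega>) + \<gamma> * q \<omega>\<bar> \<le> K + \<gamma> / 2 * q \<omega>" for \<omega>
  proof -
    define x where "x = W \<omega>"
    have 1: "\<bar>(2 * \<nu> + 1) * f1 x\<bar> \<le> 2 * \<nu> + 1"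
    proof -
      have "\<bar>f1 x\<bar> \<le> 1" using f1_le[of x] N(1)[of "x - \<mu>"] N(2)[of "x - \<mu>"] by (simp add: order.trans)
      then show ?thesis using \<nu> mult_left_mono[of "\<bar>f1 x\<bar>" 1 "2 * \<nu> + 1"] by (simp add: abs_mult)
    qed
    have 2: "\<bar>2 * \<beta> * ((x - \<mu>) * f1 x)\<bar> \<le> 2 * \<bar>\<beta>\<bar> * \<bar>f x\<bar>"
    proof -
      have "\<bar>(x - \<mu>) * f1 x\<bar> \<le> \<bar>x - \<mu>\<bar> * (1 / N (x - \<mu>))"
        unfolding abs_mult using f1_le by (intro mult_left_mono) auto
      also have "\<dots> = \<bar>f x\<bar>" by (simp add: f_abs)
      finally show ?thesis by (simp add: abs_mult mult_left_mono mult.assoc)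
    qed
    have 3: "\<bar>(2 * \<nu> + 1) * \<beta> * f x\<bar> \<le> (2 * \<nu> + 1) * \<bar>\<beta>\<bar> * \<bar>f x\<bar>"
      using \<nu> by (simp add: abs_mult)
    have "F x + \<gamma> * q \<omega> = (x - \<mu>) * f2 x + (2 * \<nu> + 1) * f1 x + 2 * \<beta> * ((x - \<mu>) * f1 x) + (2 * \<nu> + 1) * \<beta> * f x"
      unfolding F_def q_eq x_def by (simp add: algebra_simps)
    then have "\<bar>F x + \<gamma> * q \<omega>\<bar> \<le> 6 + (2 * \<nu> + 1) + 2 * \<bar>\<beta>\<bar> * \<bar>f x\<bar> + (2 * \<nu> + 1) * \<bar>\<beta>\<bar> * \<bar>f x\<bar>"
      using yf2_le[of x] 1 2 3 by linarith
    also have "\<dots> = 2 * \<nu> + 7 + b * \<bar>f x\<bar>" by (simp add: b_def algebra_simps)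
    also have "\<dots> \<le> K + \<gamma> / 2 * q \<omega>" using b_f_le[of \<omega>] by (simp add: K_def x_def)
    finally show ?thesis by (simp add: x_def)
  qed
  have F_int: "integrable M (\<lambda>\<omega>. F (W \<omega>))"
  proof (rule Bochner_Integration.integrable_bound)
    show "integrable M (\<lambda>\<omega>. K + 3 / 2 * \<gamma> * q \<omega>)" using q_int by simp
    show "AE \<omega> in M. norm (F (W \<omega>)) \<le> norm (K + 3 / 2 * \<gamma> * q \<omega>)"
    proof (intro AE_I2)
      fix \<omega>
      have "\<gamma> * q \<omega> \<ge> 0" using \<gamma>_pos q_nonneg by simp
      then show "norm (F (W \<omega>)) \<le> norm (K + 3 / 2 * \<gamma> * q \<omega>)"
        using F_bound[of \<omega>] by (simp add: abs_le_iff)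
    qed
    show "(\<lambda>\<omega>. F (W \<omega>)) \<in> borel_measurable M"
      unfolding F_def f_def f1_def f2_def N_def by measurable
  qed
  \<comment> \<open>The common bound 6 / \<epsilon> works because |f| \<le> 1 / \<epsilon>, |f1|
    \<le> 1 and |f2| \<le> 6 \<epsilon> |f|, with \<epsilon> \<le> 1.\<close>
  have "(\<integral>\<omega>. F (W \<omega>) \<partial>M) = 0"
  proof (rule stein_char_bounded[OF stein d1 d2 _ _ _ _ _ F_int])
    show "continuous_on UNIV f2"
      unfolding f2_def N_def using N(3)[unfolded N_def] by (intro continuous_intros) auto
    show "\<bar>f x\<bar> \<le> 6 / \<epsilon>" for x using f_le[of x] \<epsilon> by (simp add: field_simps)
    show "\<bar>f1 x\<bar> \<le> 6 / \<epsilon>" for x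
    proof -
      have "\<bar>f1 x\<bar> \<le> 1" using f1_le[of x] N(1)[of "x - \<mu>"] N(2)[of "x - \<mu>"] by (simp add: order.trans)
      also have "1 \<le> 6 / \<epsilon>" using \<epsilon> by (simp add: field_simps)
      finally show ?thesis .
    qed
    show "\<bar>f2 x\<bar> \<le> 6 / \<epsilon>" for x
    proof -
      have "6 * \<epsilon> * \<bar>f x\<bar> \<le> 6 * \<bar>f x\<bar>" using \<epsilon> by (intro mult_right_mono) auto
      then show ?thesis using f2_le[of x] f_le[of x] by simp
    qed
  qed (simp add: F_def)
  \<comment> \<open>Taking expectations removes F and leaves a bound in which \<epsilon> does not
    occur.\<close>
  moreover have "(\<integral>\<omega>. \<gamma> / 2 * q \<omega> \<partial>M) \<le> (\<integral>\<omega>. K - F (W \<omega>) \<partial>M)"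
  proof (rule integral_mono)
    show "\<gamma> / 2 * q \<omega> \<le> K - F (W \<omega>)" for \<omega> using F_bound[of \<omega>] by (simp add: abs_le_iff) 
  qed (use q_int F_int in auto)
  ultimately have "\<gamma> / 2 * (\<integral>\<omega>. q \<omega> \<partial>M) \<le> K" using F_int by (simp add: prob_space)
  then show "(\<integral>\<omega>. q \<omega> \<partial>M) \<le> 2 * (2 * \<nu> + 7 + b\<^sup>2 / (2 * \<gamma>)) / \<gamma>"
    unfolding K_def[symmetric] using \<gamma>_pos by (simp add: field_simps)
qed

text \<open>As \<epsilon> tends to 0 the truncated squares tend to (W - \<mu>)^2, and Fatou's lemma
  carries the uniform bound to the second moment. The first moment follows from |y| \<le> 1 +
  y^2.\<close>

lemma stein_char_integrable:
  assumes M: "prob_space M" and W: "W \<in> borel_measurable M" and stein: "stein_char M W"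
  shows "integrable M (\<lambda>\<omega>. W \<omega> - \<mu>)"
proof -
  interpret prob_space M by (rule M)
  note [measurable] = W
  \<comment> \<open>The choice \<epsilon> = 1 / (n + 1) stays in (0, 1] also for n = 0.\<close>
  define q where "q = (\<lambda>n \<omega>. (W \<omega> - \<mu>)\<^sup>2 / (1 + 1 / real (Suc n) * (W \<omega> - \<mu>)\<^sup>2))"
  define b where "b = 2 * \<bar>\<beta>\<bar> + (2 * \<nu> + 1) * \<bar>\<beta>\<bar>"
  define L where "L = 2 * (2 * \<nu> + 7 + b\<^sup>2 / (2 * \<gamma>)) / \<gamma>"
  have q: "integrable M (q n)" "(\<integral>\<omega>. q n \<omega> \<partial>M) \<le> L" for n
    using stein_char_truncated_moment[OF M W stein, of "1 / real (Suc n)"]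
    by (simp_all add: q_def L_def b_def)
  have q_nonneg: "q n \<omega> \<ge> 0" for n \<omega> by (simp add: q_def)
  have lim: "(\<lambda>n. q n \<omega>) \<longlonglongrightarrow> (W \<omega> - \<mu>)\<^sup>2" for \<omega>
  proof -
    have "(\<lambda>n. 1 / real (Suc n)) \<longlonglongrightarrow> 0" using LIMSEQ_inverse_real_of_nat by (simp add: inverse_eq_divide)
    then have "(\<lambda>n. (W \<omega> - \<mu>)\<^sup>2 / (1 + 1 / real (Suc n) * (W \<omega> - \<mu>)\<^sup>2)) \<longlonglongrightarrow> (W \<omega> - \<mu>)\<^sup>2 / (1 + 0 * (W \<omega> - \<mu>)\<^sup>2)"
      by (intro tendsto_intros) auto
    then show ?thesis by (simp add: q_def)
  qed
  have "(\<integral>\<^sup>+\<omega>. ennreal ((W \<omega> - \<mu>)\<^sup>2) \<partial>M) = (\<integral>\<^sup>+\<omega>. liminf (\<lambda>n. ennreal (q n \<omega>)) \<partial>M)"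
    using lim by (intro nn_integral_cong lim_imp_Liminf[symmetric] tendsto_ennrealI) auto
  also have "\<dots> \<le> liminf (\<lambda>n. \<integral>\<^sup>+\<omega>. ennreal (q n \<omega>) \<partial>M)"
    unfolding q_def by (intro nn_integral_liminf) measurable
  also have "\<dots> \<le> ennreal L"
    using q q_nonneg by (intro Liminf_le always_eventually allI) (auto simp: nn_integral_eq_integral ennreal_leI)
  finally have sq: "integrable M (\<lambda>\<omega>. (W \<omega> - \<mu>)\<^sup>2)"
    by (intro integrableI_nonneg) (auto simp: top.extremum_unique less_top[symmetric])
  show ?thesis
  proof (rule Bochner_Integration.integrable_bound)
    show "integrable M (\<lambda>\<omega>. 1 + (W \<omega> - \<mu>)\<^sup>2)" using sq by simp
    show "AE \<omega> in M. norm (W \<omega> - \<mu>) \<le> norm (1 + (W \<omega> - \<mu>)\<^sup>2)"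
    proof (intro AE_I2)
      fix \<omega>
      have "\<bar>y\<bar> \<le> 1 + y\<^sup>2" for y :: real
      proof -
        have "0 \<le> (\<bar>y\<bar> - 1)\<^sup>2" by simp
        then have "2 * \<bar>y\<bar> \<le> 1 + y\<^sup>2" by (simp add: power2_eq_square algebra_simps)
        then show ?thesis by linarith
      qed
      then show "norm (W \<omega> - \<mu>) \<le> norm (1 + (W \<omega> - \<mu>)\<^sup>2)" by simp
    qed
  qed measurable
qed

text \<open>With y = x - \<mu>, the Stein operator maps exp (i t y) to exp (i t y) times (2 \<nu> +
  1) (\<beta> + i t) - (\<gamma> + t^2 - 2 i \<beta> t) y. The cosine and sine are its real and
  imaginary test functions. This image is affine in y up to a bounded factor, so the first moment
  gives integrability.\<close>

lemma stein_char_ode: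
  assumes M: "prob_space M" and W: "W \<in> borel_measurable M" and stein: "stein_char M W"
  shows "(\<integral>\<omega>. iexp (t * (W \<omega> - \<mu>)) * (W \<omega> - \<mu>) \<partial>M) * (\<gamma> + t\<^sup>2 - 2 * \<i> * \<beta> * t) =
    (2 * \<nu> + 1) * (\<beta> + \<i> * t) * (\<integral>\<omega>. iexp (t * (W \<omega> - \<mu>)) \<partial>M)"
proof -
  interpret prob_space M by (rule M)
  note [measurable] = W
  define Y where "Y = (\<lambda>\<omega>. W \<omega> - \<mu>)"
  have [measurable]: "Y \<in> borel_measurable M" unfolding Y_def by measurable
  have Y: "integrable M Y" using stein_char_integrable[OF assms] by (simp add: Y_def)
  define A where "A = (\<lambda>f2 f1 f x. (x - \<mu>) * f2 x + (2 * \<nu> + 1 + 2 * \<beta> * (x - \<mu>)) * f1 x + ((2 * \<nu> + 1) * \<beta> - \<gamma> * (x - \<mu>)) * (f x :: real))"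
  define Fc where "Fc = A (\<lambda>x. - (t\<^sup>2 * cos (t * (x - \<mu>)))) (\<lambda>x. - (t * sin (t * (x - \<mu>)))) (\<lambda>x. cos (t * (x - \<mu>)))"
  define Fs where "Fs = A (\<lambda>x. - (t\<^sup>2 * sin (t * (x - \<mu>)))) (\<lambda>x. t * cos (t * (x - \<mu>))) (\<lambda>x. sin (t * (x - \<mu>)))"
  \<comment> \<open>One bound for the trigonometric functions and their first two derivatives, whose
    amplitudes are 1, |t| and t^2.\<close>
  define B where "B = 1 + \<bar>t\<bar> + t\<^sup>2"
  have bdd: "\<bar>x\<bar> \<le> B" "\<bar>t * x\<bar> \<le> B" "\<bar>t\<^sup>2 * x\<bar> \<le> B" if "\<bar>x\<bar> \<le> 1" for x
  proof -
    have "\<bar>t * x\<bar> = \<bar>t\<bar> * \<bar>x\<bar>" "\<bar>t\<^sup>2 * x\<bar> = t\<^sup>2 * \<bar>x\<bar>" by (auto simp: abs_mult)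
    then show "\<bar>x\<bar> \<le> B" "\<bar>t * x\<bar> \<le> B" "\<bar>t\<^sup>2 * x\<bar> \<le> B"
      using mult_left_mono[OF that, of "\<bar>t\<bar>"] mult_left_mono[OF that, of "t\<^sup>2"] that
        zero_le_power2[of t] abs_ge_zero[of t] unfolding B_def by linarith+
  qed
  have int_bdd: "integrable M (\<lambda>\<omega>. g (W \<omega>))" "integrable M (\<lambda>\<omega>. Y \<omega> * g (W \<omega>))"
    if [measurable]: "g \<in> borel_measurable borel" and g: "\<And>x. \<bar>g x\<bar> \<le> B" for g
  proof -
    show "integrable M (\<lambda>\<omega>. g (W \<omega>))"
      using g by (intro integrable_const_bound[where B = B]) auto
    show "integrable M (\<lambda>\<omega>. Y \<omega> * g (W \<omega>))"
    proof (rule Bochner_Integration.integrable_bound)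
      show "integrable M (\<lambda>\<omega>. B * Y \<omega>)" using Y by simp
      have "B \<ge> 0" by (simp add: B_def)
      then show "AE \<omega> in M. norm (Y \<omega> * g (W \<omega>)) \<le> norm (B * Y \<omega>)"
        using g by (intro AE_I2) (simp add: abs_mult mult_mono mult.commute[of B])
    qed measurable
  qed
  have A_int: "integrable M (\<lambda>\<omega>. A f2 f1 f (W \<omega>))"
    if "f2 \<in> borel_measurable borel" "f1 \<in> borel_measurable borel" "f \<in> borel_measurable borel"
      "\<And>x. \<bar>f2 x\<bar> \<le> B" "\<And>x. \<bar>f1 x\<bar> \<le> B" "\<And>x. \<bar>f x\<bar> \<le> B" for f2 f1 f
  proof -
    have "integrable M (\<lambda>\<omega>. Y \<omega> * f2 (W \<omega>) + (2 * \<nu> + 1) * f1 (W \<omega>) + 2 * \<beta> * (Y \<omega> * f1 (W \<omega>))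
        + (2 * \<nu> + 1) * \<beta> * f (W \<omega>) - \<gamma> * (Y \<omega> * f (W \<omega>)))"
      using that by (intro Bochner_Integration.integrable_add Bochner_Integration.integrable_diff integrable_mult_right int_bdd)
    then show ?thesis by (simp add: A_def Y_def algebra_simps)
  qed
  have Fc_int: "integrable M (\<lambda>\<omega>. Fc (W \<omega>))" and Fs_int: "integrable M (\<lambda>\<omega>. Fs (W \<omega>))"
    unfolding Fc_def Fs_def by (rule A_int; simp add: bdd)+
  have "(\<integral>\<omega>. Fc (W \<omega>) \<partial>M) = 0"
    by (rule stein_char_bounded[OF stein, where B = B and f = "\<lambda>x. cos (t * (x - \<mu>))"
          and ?f1.0 = "\<lambda>x. - (t * sin (t * (x - \<mu>)))" and ?f2.0 = "\<lambda>x. - (t\<^sup>2 * cos (t * (x - \<mu>)))"])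
       (auto intro!: derivative_eq_intros continuous_intros Fc_int simp: bdd bdd(3)[unfolded power2_eq_square] power2_eq_square[of t], simp_all add: Fc_def A_def power2_eq_square)
  moreover have "(\<integral>\<omega>. Fs (W \<omega>) \<partial>M) = 0"
    by (rule stein_char_bounded[OF stein, where B = B and f = "\<lambda>x. sin (t * (x - \<mu>))"
          and ?f1.0 = "\<lambda>x. t * cos (t * (x - \<mu>))" and ?f2.0 = "\<lambda>x. - (t\<^sup>2 * sin (t * (x - \<mu>)))"])
       (auto intro!: derivative_eq_intros continuous_intros Fs_int simp: bdd bdd(3)[unfolded power2_eq_square] power2_eq_square[of t], simp_all add: Fs_def A_def power2_eq_square)
  ultimately have "0 = (\<integral>\<omega>. complex_of_real (Fc (W \<omega>)) + \<i> * complex_of_real (Fs (W \<omega>)) \<partial>M)"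
    using Fc_int Fs_int by (simp add: integral_complex_of_real)
  also have "\<dots> = (\<integral>\<omega>. (2 * \<nu> + 1) * (\<beta> + \<i> * t) * iexp (t * Y \<omega>)
      - (\<gamma> + t\<^sup>2 - 2 * \<i> * \<beta> * t) * (iexp (t * Y \<omega>) * Y \<omega>) \<partial>M)"
    by (intro Bochner_Integration.integral_cong refl)
       (simp add: Fc_def Fs_def A_def Y_def complex_eq_iff Re_exp Im_exp algebra_simps power2_eq_square)
  also have "\<dots> = (2 * \<nu> + 1) * (\<beta> + \<i> * t) * (\<integral>\<omega>. iexp (t * Y \<omega>) \<partial>M)
      - (\<gamma> + t\<^sup>2 - 2 * \<i> * \<beta> * t) * (\<integral>\<omega>. iexp (t * Y \<omega>) * Y \<omega> \<partial>M)"
  proof -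
    have "integrable M (\<lambda>\<omega>. iexp (t * Y \<omega>))"
      by (intro integrable_const_bound[where B = 1]) auto
    moreover have "integrable M (\<lambda>\<omega>. iexp (t * Y \<omega>) * Y \<omega>)"
      by (rule Bochner_Integration.integrable_bound[OF Y]) (auto simp: norm_mult)
    ultimately show ?thesis by (simp add: Bochner_Integration.integral_diff)
  qed
  finally show ?thesis by (simp add: Y_def mult.commute)
qed

text \<open>Let D(t) be the quadratic in the denominator. Since D'(t) = - 2 i (\<beta> + i t), the
  previous identity says that \<phi> D^(\<nu> + 1/2) has derivative zero; its value at t = 0 is
  \<gamma>^(\<nu> + 1/2).\<close>

lemma stein_char_characteristic_function:
  assumes M: "prob_space M" and W: "W \<in> borel_measurable M" and stein: "stein_char M W"
  shows "(\<integral>\<omega>. iexp (t * (W \<omega> - \<mu>)) \<partial>M) =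
    complex_of_real \<gamma> powr (\<nu> + 1/2) / (\<gamma> + t\<^sup>2 - 2 * \<i> * \<beta> * t) powr (\<nu> + 1/2)"
proof -
  interpret prob_space M by (rule M)
  note [measurable] = W
  define Y where "Y = (\<lambda>\<omega>. W \<omega> - \<mu>)"
  have [measurable]: "Y \<in> borel_measurable M" unfolding Y_def by measurable
  have Y: "integrable M Y" using stein_char_integrable[OF assms] by (simp add: Y_def)
  define \<phi> where "\<phi> = (\<lambda>t. \<integral>\<omega>. iexp (t * Y \<omega>) \<partial>M)"
  define m where "m = (\<lambda>t. \<integral>\<omega>. iexp (t * Y \<omega>) * Y \<omega> \<partial>M)"
  define Q where "Q = (\<lambda>z::complex. \<gamma> + z\<^sup>2 - 2 * \<i> * \<beta> * z)"
  define \<kappa> where "\<kappa> = complex_of_real (\<nu> + 1/2)"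
  have ode: "m t * Q t = 2 * \<kappa> * (\<beta> + \<i> * t) * \<phi> t" for t :: real
    using stein_char_ode[OF assms, of t] by (simp add: m_def Q_def \<kappa>_def \<phi>_def Y_def)
  \<comment> \<open>The derivative of the integrand has modulus |Y|, which is integrable and does
    not depend on t.\<close>
  have d\<phi>: "(\<phi> has_vector_derivative \<i> * m t) (at t)" for t
  proof -
    have "(\<phi> has_vector_derivative (\<integral>\<omega>. \<i> * (iexp (t * Y \<omega>) * Y \<omega>) \<partial>M)) (at t)"
      unfolding \<phi>_def
    proof (rule has_vector_derivative_integral[where U = UNIV and g = "\<lambda>\<omega>. \<bar>Y \<omega>\<bar>"])
      fix s \<omega>
      have "((\<lambda>z. exp (\<i> * (z * complex_of_real (Y \<omega>)))) has_field_derivative \<i> * (iexp (s * Y \<omega>) * Y \<omega>)) (at (complex_of_real s))"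
        by (auto intro!: derivative_eq_intros)
      from has_vector_derivative_real_field[OF this]
      show "((\<lambda>s. iexp (s * Y \<omega>)) has_vector_derivative \<i> * (iexp (s * Y \<omega>) * Y \<omega>)) (at s)" by simp
      show "norm (\<i> * (iexp (s * Y \<omega>) * Y \<omega>)) \<le> \<bar>Y \<omega>\<bar>" by (simp add: norm_mult)
      show "integrable M (\<lambda>\<omega>. iexp (s * Y \<omega>))"
        by (intro integrable_const_bound[where B = 1]) auto
    qed (use Y in auto)
    then show ?thesis by (simp add: m_def)
  qed
  have Q_Re: "Re (Q t) > 0" for t :: real using \<gamma>_pos by (simp add: Q_def add_pos_nonneg power2_eq_square)
  \<comment> \<open>The real part \<gamma> + t^2 is positive, so the curve avoids the branch cut of
    the principal power.\<close>
  have Q_ne: "Q t \<notin> \<real>\<^sub>\<le>\<^sub>0" "Q t \<noteq> 0" for t :: real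
    using Q_Re[of t] by (auto simp: complex_nonpos_Reals_iff)
  define \<Phi> where "\<Phi> = (\<lambda>t. \<phi> t * Q (of_real t) powr \<kappa>)"
  have "(\<Phi> has_vector_derivative 0) (at t)" for t
  proof -
    have "(Q has_field_derivative 2 * of_real t - 2 * \<i> * \<beta>) (at (of_real t))"
      unfolding Q_def by (auto intro!: derivative_eq_intros)
    from DERIV_chain2[OF has_field_derivative_powr[OF Q_ne(1)] this]
    have "((\<lambda>t. Q (of_real t) powr \<kappa>) has_vector_derivative
        \<kappa> * Q (of_real t) powr (\<kappa> - 1) * (2 * of_real t - 2 * \<i> * \<beta>)) (at t)"
      by (rule has_vector_derivative_real_field)
    from has_vector_derivative_mult[OF d\<phi> this]
    have "(\<Phi> has_vector_derivative \<phi> t * (\<kappa> * Q (of_real t) powr (\<kappa> - 1) * (2 * of_real t - 2 * \<i> * \<beta>))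
        + \<i> * m t * Q (of_real t) powr \<kappa>) (at t)"
      by (simp add: \<Phi>_def)
    moreover have "\<phi> t * (\<kappa> * Q (of_real t) powr (\<kappa> - 1) * (2 * of_real t - 2 * \<i> * \<beta>)) + \<i> * m t * Q (of_real t) powr \<kappa> = 0"
    proof -
      define R where "R = Q (of_real t) powr (\<kappa> - 1)"
      have "Q (of_real t) powr \<kappa> = Q (of_real t) * R"
        using Q_ne(2)[of t] by (simp add: R_def powr_diff)
      then have "\<phi> t * (\<kappa> * R * (2 * of_real t - 2 * \<i> * \<beta>)) + \<i> * m t * Q (of_real t) powr \<kappa> =
          \<phi> t * (\<kappa> * R * (2 * of_real t - 2 * \<i> * \<beta>)) + \<i> * (m t * Q (of_real t)) * R"
        by (simp add: mult_ac)
      also have "\<dots> = 0" unfolding ode by (simp add: algebra_simps)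
      finally show ?thesis by (simp add: R_def)
    qed
    ultimately show ?thesis by simp
  qed
  then obtain c where c: "\<And>t. \<Phi> t = c"
    using has_vector_derivative_zero_constant[of UNIV \<Phi>] by auto
  have "\<Phi> 0 = complex_of_real \<gamma> powr \<kappa>" by (simp add: \<Phi>_def \<phi>_def Q_def prob_space)
  then have "\<phi> t * Q (of_real t) powr \<kappa> = complex_of_real \<gamma> powr \<kappa>" using c[of t] c[of 0] by (simp add: \<Phi>_def)
  then have "\<phi> t = complex_of_real \<gamma> powr \<kappa> / Q (of_real t) powr \<kappa>"
    using Q_ne(2)[of t] by (simp add: field_simps)
  then show ?thesis by (simp add: \<phi>_def Y_def Q_def \<kappa>_def)
qed

section \<open>Identification of the law\<close>

lemma integral_iexp_shift:
  "(\<integral>\<omega>. iexp (t * X \<omega>) \<partial>N) = iexp (t * c) * (\<integral>\<omega>. iexp (t * (X \<omega> - c)) \<partial>N)"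
proof -
  have "iexp (t * X \<omega>) = iexp (t * c) * iexp (t * (X \<omega> - c))" for \<omega>
    by (simp add: algebra_simps flip: exp_add)
  then show ?thesis by simp
qed

text \<open>The characteristic function of the variance-gamma law is not computed from its density.
  The identity map under that law satisfies the Stein condition by the first half, so the same
  closed formula holds for it as for W.\<close>

lemma stein_char_imp_distributed:
  assumes M: "prob_space M" and W: "W \<in> borel_measurable M" and stein: "stein_char M W"
  shows "distributed M lborel W (\<lambda>x. ennreal (p x))"
proof -
  interpret prob_space M by (rule M)
  note [measurable] = W
  define V where "V = density lborel (\<lambda>x. ennreal (p x))"
  have V: "prob_space V" unfolding V_def by (rule prob_space_VG2)
  have sets_V [measurable_cong]: "sets V = sets borel" by (simp add: V_def)
  have "distributed V lborel (\<lambda>x. x) (\<lambda>x. ennreal (p x))"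
    by (auto simp: distributed_def V_def distr_id2)
  then have steinV: "stein_char V (\<lambda>x. x)" by (rule distributed_imp_stein_char)
  have "distr M borel W = V"
  proof (rule Levy_uniqueness)
    show "real_distribution (distr M borel W)"
      by (intro real_distribution_distr W)
    show "real_distribution V"
      using V sets_V by (simp add: real_distribution_def real_distribution_axioms_def)
    show "char (distr M borel W) = char V"
    proof
      fix t
      have "char (distr M borel W) t = (\<integral>\<omega>. iexp (t * W \<omega>) \<partial>M)"
        by (simp add: char_def integral_distr)
      also have "\<dots> = (\<integral>x. iexp (t * x) \<partial>V)"
        unfolding integral_iexp_shift[where X = W and c = \<mu>] integral_iexp_shift[where X = "\<lambda>x. x" and c = \<mu>]
          stein_char_characteristic_function[OF M W stein]
        by (subst stein_char_characteristic_function[OF V _ steinV]) auto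
      finally show "char (distr M borel W) t = char V t" by (simp add: char_def)
    qed
  qed
  moreover have "distr M lborel W = distr M borel W" by (intro distr_cong) auto
  ultimately show ?thesis by (simp add: distributed_def V_def)
qed

end

theorem lemma3p1:
  fixes \<nu> \<mu> \<alpha> \<beta> :: real and M :: "'a measure" and W :: "'a \<Rightarrow> real"
  assumes "\<nu> > - 1/2" and "\<alpha> > \<bar>\<beta>\<bar>"
    and "prob_space M" and "W \<in> borel_measurable M"
  shows "distributed M lborel W (\<lambda>x. ennreal (VG2_density \<nu> \<alpha> \<beta> \<mu> x)) \<longleftrightarrow>
    (\<forall>f :: real \<Rightarrow> real.
       piecewise_C2 f \<longrightarrow>
       (\<forall>k\<le>2.
          ((\<lambda>x. (deriv ^^ k) f x * x powr (\<nu> + 3/2) * exp (- (\<alpha> - \<beta>) * x)) \<longlongrightarrow> 0) at_top \<and>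
          ((\<lambda>x. (deriv ^^ k) f x * (- x) powr (\<nu> + 3/2) * exp ((\<alpha> + \<beta>) * x)) \<longlongrightarrow> 0) at_bot) \<longrightarrow>
       integrable M (\<lambda>\<omega>. stein_VG2 \<nu> \<alpha> \<beta> \<mu> f (W \<omega>)) \<longrightarrow>
       (\<integral>\<omega>. stein_VG2 \<nu> \<alpha> \<beta> \<mu> f (W \<omega>) \<partial>M) = 0)"
proof -
  interpret VG2_params \<nu> \<alpha> \<beta> \<mu> using assms(1,2) by unfold_locales
  show ?thesis
    using distributed_imp_stein_char stein_char_imp_distributed[OF assms(3,4)]
    unfolding stein_char_def by blast
qed

end
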